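(* Let $A$ be a T-brace which is Smoktunowicz-nilpotent, and suppose that the upper $\star$-central series of $A$ has length $k$ for some positive integer $k$ (i.e. $\zeta_k(\star,A)=A$ and $\zeta_{k-1}(\star,A)\neq A$). If the additive group of $A$ is not periodic, then for every prime $p$ the Sylow $p$-subgroup of the additive group of $K=A\star A$ is finite of order at most $p^{k-1}$.
   Context: A (left) brace is a set $A$ with two operations $+$ and $\cdot$ such that $(A,+)$ is an abelian group, $(A,\cdot)$ is a group, and $a(b+c)=ab+ac-a$ for all $a,b,c\in A$. Put $a\star b=ab-a-b$; for subsets $K,L$, $K\star L$ is the subgroup of $(A,+)$ generated by all $x\star y$, $x\in K$, $y\in L$. A subbrace is a subset which is a subgroup of both $(A,+)$ and $(A,\cdot)$; a subbrace $L$ is an ideal if $a\star z, z\star a\in L$ for all $a\in A$, $z\in L$, and then the quotient brace $A/L$ is defined. $A$ is a T-brace if whenever $I$ is an ideal of $J$ and $J$ is an ideal of $A$, then $I$ is an ideal of $A$. The $\star$-center is $\zeta(\star,A)=\{a: a\star x=x\star a=0\ \forall x\}$; the upper $\star$-central series is $\zeta_0(\star,A)=0$, $\zeta_{\alpha+1}(\star,A)/\zeta_\alpha(\star,A)=\zeta(\star,A/\zeta_\alpha(\star,A))$, unions at limit ordinals. Define $A^{(1)}=A$, $A^{(n+1)}=A^{(n)}\star A$, $A^1=A$, $A^{n+1}=A\star A^n$; $A$ is Smoktunowicz-nilpotent if $A^{(n)}=A^m=0$ for some natural numbers $n,m$ (equivalently, $\zeta_j(\star,A)=A$ for some finite $j$).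 *)

theory Defs
  imports "HOL-Algebra.Generated_Groups" "HOL-Computational_Algebra.Primes"
begin

text \<open>A (left) brace is given by an additive structure P (a commutative group,
written with the HOL-Algebra multiplicative notation of P) and a multiplicative
structure M (a group) on the same carrier, satisfying a(b+c) = ab + ac - a.\<close>

definition brace :: "'a monoid \<Rightarrow> 'a monoid \<Rightarrow> bool" where
  "brace P M \<longleftrightarrow> comm_group P \<and> group M \<and> carrier M = carrier P \<and>
     (\<forall>a\<in>carrier P. \<forall>b\<in>carrier P. \<forall>c\<in>carrier P.
        a \<otimes>\<^bsub>M\<^esub> (b \<otimes>\<^bsub>P\<^esub> c)
        = ((a \<otimes>\<^bsub>M\<^esub> b) \<otimes>\<^bsub>P\<^esub> (a \<otimes>\<^bsub>M\<^esub> c)) \<otimes>\<^bsub>P\<^esub> inv\<^bsub>P\<^esub> a)"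

definition bstar :: "'a monoid \<Rightarrow> 'a monoid \<Rightarrow> 'a \<Rightarrow> 'a \<Rightarrow> 'a" where
  "bstar P M a b = ((a \<otimes>\<^bsub>M\<^esub> b) \<otimes>\<^bsub>P\<^esub> inv\<^bsub>P\<^esub> a) \<otimes>\<^bsub>P\<^esub> inv\<^bsub>P\<^esub> b"

definition bstar_set :: "'a monoid \<Rightarrow> 'a monoid \<Rightarrow> 'a set \<Rightarrow> 'a set \<Rightarrow> 'a set" where
  "bstar_set P M K L = generate P {bstar P M x y | x y. x \<in> K \<and> y \<in> L}"

definition subbrace :: "'a monoid \<Rightarrow> 'a monoid \<Rightarrow> 'a set \<Rightarrow> bool" where
  "subbrace P M L \<longleftrightarrow> subgroup L P \<and> subgroup L M"

definition brace_ideal_in :: "'a monoid \<Rightarrow> 'a monoid \<Rightarrow> 'a set \<Rightarrow> 'a set \<Rightarrow> bool" where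
  "brace_ideal_in P M I J \<longleftrightarrow> subbrace P M I \<and> I \<subseteq> J \<and>
     (\<forall>a\<in>J. \<forall>z\<in>I. bstar P M a z \<in> I \<and> bstar P M z a \<in> I)"

definition brace_ideal :: "'a monoid \<Rightarrow> 'a monoid \<Rightarrow> 'a set \<Rightarrow> bool" where
  "brace_ideal P M L \<longleftrightarrow> brace_ideal_in P M L (carrier P)"

definition T_brace :: "'a monoid \<Rightarrow> 'a monoid \<Rightarrow> bool" where
  "T_brace P M \<longleftrightarrow> brace P M \<and>
     (\<forall>I J. brace_ideal_in P M I J \<and> subbrace P M J \<and> brace_ideal P M J
            \<longrightarrow> brace_ideal P M I)"

text \<open>Shifted indexing: right_pow P M n = A^{(n+1)}, left_pow P M n = A^{n+1}.\<close>
primrec right_pow :: "'a monoid \<Rightarrow> 'a monoid \<Rightarrow> nat \<Rightarrow> 'a set" where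
  "right_pow P M 0 = carrier P"
| "right_pow P M (Suc n) = bstar_set P M (right_pow P M n) (carrier P)"

primrec left_pow :: "'a monoid \<Rightarrow> 'a monoid \<Rightarrow> nat \<Rightarrow> 'a set" where
  "left_pow P M 0 = carrier P"
| "left_pow P M (Suc n) = bstar_set P M (carrier P) (left_pow P M n)"

definition smok_nilpotent :: "'a monoid \<Rightarrow> 'a monoid \<Rightarrow> bool" where
  "smok_nilpotent P M \<longleftrightarrow>
     (\<exists>n m. right_pow P M n = {\<one>\<^bsub>P\<^esub>} \<and> left_pow P M m = {\<one>\<^bsub>P\<^esub>})"

text \<open>Upper star-central series (finite terms): zeta_{n+1} is the preimage of
the star-centre of A/zeta_n, i.e. elements a with a\<star>x, x\<star>a \<in> zeta_n for all x.\<close>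
primrec zeta :: "'a monoid \<Rightarrow> 'a monoid \<Rightarrow> nat \<Rightarrow> 'a set" where
  "zeta P M 0 = {\<one>\<^bsub>P\<^esub>}"
| "zeta P M (Suc n) = {a \<in> carrier P. \<forall>x\<in>carrier P.
       bstar P M a x \<in> zeta P M n \<and> bstar P M x a \<in> zeta P M n}"

definition periodic_group :: "'a monoid \<Rightarrow> bool" where
  "periodic_group G \<longleftrightarrow> (\<forall>a\<in>carrier G. \<exists>n::nat. n > 0 \<and> a [^]\<^bsub>G\<^esub> n = \<one>\<^bsub>G\<^esub>)"

definition p_component :: "'a monoid \<Rightarrow> nat \<Rightarrow> 'a set \<Rightarrow> 'a set" where
  "p_component G p K = {x \<in> K. \<exists>n::nat. x [^]\<^bsub>G\<^esub> (p ^ n) = \<one>\<^bsub>G\<^esub>}"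

end

theory Submission
  imports Defs
begin

text \<open>
In a star-nilpotent T-brace every subbrace is an ideal. Write \<open>gen a\<close> for the ideal generated
by \<open>a\<close>, so \<open>gen a = \<int>a + gen (a \<star> a)\<close>. Since the additive group is not periodic, there is a
\<open>\<star>\<close>-central element of infinite order, and this forces \<open>y \<star> a\<close> and \<open>a \<star> y\<close> to lie in
\<open>gen (a \<star> a)\<close> for all \<open>y\<close>. Put \<open>c = a \<star> a\<close>. Comparing \<open>na \<star> a\<close> with \<open>na \<star> na\<close> shows that the
order of \<open>c\<close> modulo \<open>gen (c \<star> c)\<close> is square-free, so that \<open>gen c\<close> has order at most
\<open>p\<^sup>k\<^sup>-\<^sup>1\<close> whenever \<open>c\<close> is a \<open>p\<close>-element. Finally, the ideals \<open>gen (a \<star> a)\<close> with \<open>a \<star> a\<close> a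
\<open>p\<close>-element form a chain, and the largest of them contains the Sylow \<open>p\<close>-subgroup of \<open>A \<star> A\<close>.
The additive group is written multiplicatively throughout, as \<open>P\<close>.
\<close>

section \<open>Arithmetic of \<open>\<star>\<close> in a left brace\<close>

locale left_brace = comm_group P for P (structure) +
  fixes M :: "'a monoid"
  assumes brace: "brace P M"
begin

abbreviation star (infixl "\<star>" 72) where "x \<star> y \<equiv> bstar P M x y"

lemma group_M: "group M" and carrier_M [simp]: "carrier M = carrier P"
  and distrib: "\<lbrakk>x \<in> carrier P; y \<in> carrier P; z \<in> carrier P\<rbrakk> \<Longrightarrow>
    x \<otimes>\<^bsub>M\<^esub> (y \<otimes> z) = ((x \<otimes>\<^bsub>M\<^esub> y) \<otimes> (x \<otimes>\<^bsub>M\<^esub> z)) \<otimes> inv x"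
  using brace unfolding brace_def by auto

lemma M_closed [simp]: "x \<in> carrier P \<Longrightarrow> y \<in> carrier P \<Longrightarrow> x \<otimes>\<^bsub>M\<^esub> y \<in> carrier P"
  using monoid.m_closed[OF group.axioms(1)[OF group_M]] by simp

lemma M_inv_closed [simp]: "x \<in> carrier P \<Longrightarrow> inv\<^bsub>M\<^esub> x \<in> carrier P"
  using group.inv_closed[OF group_M] by simp

lemma star_closed [simp]: "x \<in> carrier P \<Longrightarrow> y \<in> carrier P \<Longrightarrow> x \<star> y \<in> carrier P"
  by (simp add: bstar_def)

lemma cancel_inv:
  assumes "x \<in> carrier P" "y \<in> carrier P"
  shows "x \<otimes> (inv x \<otimes> y) = y" "inv x \<otimes> (x \<otimes> y) = y"
    "x \<otimes> (y \<otimes> inv x) = y" "inv x \<otimes> (y \<otimes> x) = y"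
  using assms m_comm[of y] by (simp_all flip: m_assoc)

text \<open>Sorting with \<open>m_ac\<close> may leave \<open>x\<close> and \<open>inv x\<close>
  apart; these rules cancel them across one or two factors.\<close>

lemma cancel_inv_nested:
  assumes "x \<in> carrier P" "a \<in> carrier P" "b \<in> carrier P" "y \<in> carrier P"
  shows "x \<otimes> (a \<otimes> (inv x \<otimes> y)) = a \<otimes> y" "inv x \<otimes> (a \<otimes> (x \<otimes> y)) = a \<otimes> y"
    "x \<otimes> (a \<otimes> (b \<otimes> inv x)) = a \<otimes> b" "inv x \<otimes> (a \<otimes> (b \<otimes> x)) = a \<otimes> b"
    "x \<otimes> (a \<otimes> (b \<otimes> (inv x \<otimes> y))) = a \<otimes> (b \<otimes> y)"
    "inv x \<otimes> (a \<otimes> (b \<otimes> (x \<otimes> y))) = a \<otimes> (b \<otimes> y)"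
  using assms m_lcomm[of x] m_lcomm[of "inv x"] by (simp_all add: cancel_inv)

lemmas cancel = cancel_inv cancel_inv_nested

lemma M_mult_eq: "x \<in> carrier P \<Longrightarrow> y \<in> carrier P \<Longrightarrow> x \<otimes>\<^bsub>M\<^esub> y = x \<otimes> y \<otimes> x \<star> y"
  unfolding bstar_def by (simp add: m_ac cancel)

lemma star_mult:
  assumes [simp]: "x \<in> carrier P" "y \<in> carrier P" "z \<in> carrier P"
  shows "x \<star> (y \<otimes> z) = x \<star> y \<otimes> x \<star> z"
proof -
  have "x \<otimes> (y \<otimes> z) \<otimes> x \<star> (y \<otimes> z) = (x \<otimes> y \<otimes> x \<star> y) \<otimes> (x \<otimes> z \<otimes> x \<star> z) \<otimes> inv x"
    by (simp add: distrib flip: M_mult_eq)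
  also have "\<dots> = x \<otimes> (y \<otimes> z) \<otimes> (x \<star> y \<otimes> x \<star> z)"
    by (simp add: m_ac cancel)
  finally show ?thesis by simp
qed

lemma star_one [simp]: "x \<in> carrier P \<Longrightarrow> x \<star> \<one> = \<one>"
  using star_mult[of x \<one> \<one>] by simp

lemma star_inv: "x \<in> carrier P \<Longrightarrow> y \<in> carrier P \<Longrightarrow> x \<star> inv y = inv (x \<star> y)"
  using star_mult[of x "inv y" y] by (simp add: inv_equality)

lemma one_M: "\<one>\<^bsub>M\<^esub> = \<one>"
proof -
  have [simp]: "\<one>\<^bsub>M\<^esub> \<in> carrier P"
    using monoid.one_closed[OF group.axioms(1)[OF group_M]] by simp
  have "\<one>\<^bsub>M\<^esub> \<otimes>\<^bsub>M\<^esub> \<one> = \<one>\<^bsub>M\<^esub> \<otimes> \<one> \<otimes> \<one>\<^bsub>M\<^esub> \<star> \<one>"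
    by (rule M_mult_eq) auto
  then show ?thesis
    using monoid.l_one[OF group.axioms(1)[OF group_M], of \<one>] by simp
qed

lemma one_star [simp]: "x \<in> carrier P \<Longrightarrow> \<one> \<star> x = \<one>"
  using M_mult_eq[of \<one> x] monoid.l_one[OF group.axioms(1)[OF group_M], of x] by (simp add: one_M)

text \<open>This is associativity of \<open>M\<close>, rewritten through \<open>M_mult_eq\<close>.
  It stands in for left distributivity: in general \<open>\<star>\<close> is additive only in its
  right argument.\<close>

lemma M_mult_star:
  assumes [simp]: "x \<in> carrier P" "y \<in> carrier P" "z \<in> carrier P"
  shows "(x \<otimes>\<^bsub>M\<^esub> y) \<star> z = x \<star> (y \<star> z) \<otimes> x \<star> z \<otimes> y \<star> z"
proof -
  have "(x \<otimes>\<^bsub>M\<^esub> y) \<otimes> z \<otimes> (x \<otimes>\<^bsub>M\<^esub> y) \<star> z = (x \<otimes>\<^bsub>M\<^esub> y) \<otimes>\<^bsub>M\<^esub> z"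
    by (simp flip: M_mult_eq)
  also have "\<dots> = x \<otimes>\<^bsub>M\<^esub> (y \<otimes>\<^bsub>M\<^esub> z)"
    using monoid.m_assoc[OF group.axioms(1)[OF group_M]] by simp
  also have "\<dots> = x \<otimes> (y \<otimes> z \<otimes> y \<star> z) \<otimes> x \<star> (y \<otimes> z \<otimes> y \<star> z)"
    by (simp add: M_mult_eq)
  also have "\<dots> = (x \<otimes>\<^bsub>M\<^esub> y) \<otimes> z \<otimes> (x \<star> (y \<star> z) \<otimes> x \<star> z \<otimes> y \<star> z)"
    by (simp add: M_mult_eq star_mult m_ac)
  finally show ?thesis by simp
qed

lemma star_pow: "x \<in> carrier P \<Longrightarrow> y \<in> carrier P \<Longrightarrow> x \<star> (y [^] (n::int)) = (x \<star> y) [^] n"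
proof -
  assume *: "x \<in> carrier P" "y \<in> carrier P"
  then have "(\<lambda>y. x \<star> y) \<in> hom P P" by (simp add: hom_def star_mult)
  with * show ?thesis using hom_int_pow[of "\<lambda>y. x \<star> y" P P y n] by (simp add: is_group)
qed

text \<open>The map \<open>w \<mapsto> c \<star> w \<otimes> w\<close> is the action of
  \<open>c\<close> on the additive group; the \<open>M\<close>-inverse of \<open>c\<close> undoes
  it.\<close>

lemma star_recover:
  assumes [simp]: "c \<in> carrier P" "w \<in> carrier P"
  shows "w = inv\<^bsub>M\<^esub> c \<star> (c \<star> w \<otimes> w) \<otimes> (c \<star> w \<otimes> w)"
proof -
  have "inv\<^bsub>M\<^esub> c \<otimes>\<^bsub>M\<^esub> c = \<one>" using group.l_inv[OF group_M, of c] by (simp add: one_M)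
  then have "inv\<^bsub>M\<^esub> c \<star> (c \<star> w) \<otimes> inv\<^bsub>M\<^esub> c \<star> w \<otimes> c \<star> w = \<one>"
    by (simp flip: M_mult_star)
  then have "w = w \<otimes> (inv\<^bsub>M\<^esub> c \<star> (c \<star> w) \<otimes> inv\<^bsub>M\<^esub> c \<star> w \<otimes> c \<star> w)" by simp
  then show ?thesis by (simp add: star_mult m_ac)
qed

text \<open>The sum \<open>x \<otimes> t\<close> is the \<open>M\<close>-product of \<open>x\<close>
  and \<open>j\<close>, where \<open>j\<close> is the image of \<open>t\<close> under the action of
  the \<open>M\<close>-inverse of \<open>x\<close>; then \<open>M_mult_star\<close> applies.\<close>

lemma mult_star_expand:
  assumes [simp]: "x \<in> carrier P" "t \<in> carrier P" "y \<in> carrier P"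
  defines "j \<equiv> t \<otimes> inv\<^bsub>M\<^esub> x \<star> t"
  shows "(x \<otimes> t) \<star> y = x \<star> (j \<star> y) \<otimes> x \<star> y \<otimes> j \<star> y"
proof -
  have j[simp]: "j \<in> carrier P" by (simp add: j_def)
  have "x \<otimes>\<^bsub>M\<^esub> inv\<^bsub>M\<^esub> x = \<one>" using group.r_inv[OF group_M, of x] by (simp add: one_M)
  then have 0: "x \<star> (inv\<^bsub>M\<^esub> x \<star> t) \<otimes> x \<star> t \<otimes> inv\<^bsub>M\<^esub> x \<star> t = \<one>"
    by (simp flip: M_mult_star)
  have "x \<otimes>\<^bsub>M\<^esub> j = x \<otimes> t \<otimes> (x \<star> (inv\<^bsub>M\<^esub> x \<star> t) \<otimes> x \<star> t \<otimes> inv\<^bsub>M\<^esub> x \<star> t)"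
    by (simp add: M_mult_eq j_def star_mult m_ac)
  also have "\<dots> = x \<otimes> t" unfolding 0 by simp
  finally show ?thesis by (simp flip: M_mult_star)
qed

section \<open>Ideals, congruences and annihilators\<close>

text \<open>The multiplicative half of being a subbrace is automatic for sets absorbing \<open>\<star>\<close>, so only
the additive subgroup condition is required.\<close>

definition star_ideal where
  "star_ideal I \<longleftrightarrow> subgroup I P \<and> (\<forall>x\<in>carrier P. \<forall>z\<in>I. x \<star> z \<in> I \<and> z \<star> x \<in> I)"

definition bcong where "bcong I x y \<longleftrightarrow> x \<in> carrier P \<and> y \<in> carrier P \<and> x \<otimes> inv y \<in> I"

text \<open>For an ideal \<open>I\<close> this is the preimage of the star-centre of the quotient by
  \<open>I\<close>, so the upper central series iterates \<open>ann\<close>.\<close>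

definition ann where "ann I = {a \<in> carrier P. \<forall>x\<in>carrier P. a \<star> x \<in> I \<and> x \<star> a \<in> I}"

lemma zeta_Suc_ann: "zeta P M (Suc n) = ann (zeta P M n)"
  by (auto simp: ann_def)

lemma star_idealD:
  assumes "star_ideal I"
  shows "subgroup I P" "\<one> \<in> I" "x \<in> I \<Longrightarrow> x \<in> carrier P" "x \<in> I \<Longrightarrow> inv x \<in> I"
    "x \<in> I \<Longrightarrow> y \<in> I \<Longrightarrow> x \<otimes> y \<in> I" "x \<in> carrier P \<Longrightarrow> y \<in> I \<Longrightarrow> x \<star> y \<in> I"
    "x \<in> carrier P \<Longrightarrow> y \<in> I \<Longrightarrow> y \<star> x \<in> I"
  using assms subgroup.mem_carrier[of I P]
  by (auto simp: star_ideal_def subgroup.m_closed subgroup.one_closed subgroup.m_inv_closed)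

lemma star_ideal_pow: "star_ideal I \<Longrightarrow> x \<in> I \<Longrightarrow> x [^] (n::int) \<in> I"
  by (auto simp: star_ideal_def intro: subgroup_int_pow_closed)

context
  fixes I assumes I: "subgroup I P"
begin

lemma bcong_refl: "x \<in> carrier P \<Longrightarrow> bcong I x x"
  using I by (simp add: bcong_def subgroup.one_closed)

lemma bcong_sym: "bcong I x y \<Longrightarrow> bcong I y x"
  using subgroup.m_inv_closed[OF I, of "x \<otimes> inv y"] by (simp add: bcong_def inv_mult m_ac)

lemma bcong_trans: "bcong I x y \<Longrightarrow> bcong I y z \<Longrightarrow> bcong I x z"
  using subgroup.m_closed[OF I, of "x \<otimes> inv y" "y \<otimes> inv z"] by (simp add: bcong_def m_ac cancel)

lemma bcong_mult: "bcong I x y \<Longrightarrow> bcong I x' y' \<Longrightarrow> bcong I (x \<otimes> x') (y \<otimes> y')"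
  using subgroup.m_closed[OF I, of "x \<otimes> inv y" "x' \<otimes> inv y'"]
  by (simp add: bcong_def inv_mult m_ac)

lemma bcong_inv: "bcong I x y \<Longrightarrow> bcong I (inv x) (inv y)"
  using subgroup.m_inv_closed[OF I, of "x \<otimes> inv y"] by (simp add: bcong_def inv_mult m_ac)

lemma bcong_pow: "bcong I x y \<Longrightarrow> bcong I (x [^] (n::int)) (y [^] n)"
  using subgroup_int_pow_closed[OF I, of "x \<otimes> inv y" n]
  by (simp add: bcong_def int_pow_distrib int_pow_inv)

lemma bcong_mem: "bcong I x y \<Longrightarrow> y \<in> I \<Longrightarrow> x \<in> I"
  using subgroup.m_closed[OF I, of "x \<otimes> inv y" y] by (simp add: bcong_def m_assoc)

lemma bcong_one_iff: "bcong I x \<one> \<longleftrightarrow> x \<in> I"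
  using subgroup.mem_carrier[OF I, of x] by (auto simp: bcong_def)

lemma bcong_mult_right: "x \<in> carrier P \<Longrightarrow> i \<in> I \<Longrightarrow> bcong I (x \<otimes> i) x"
  using subgroup.mem_carrier[OF I, of i] by (auto simp: bcong_def m_ac cancel)

lemma bcongE: assumes "bcong I x y" obtains i where "i \<in> I" "x = y \<otimes> i"
  using assms by (intro that[of "x \<otimes> inv y"]) (auto simp: bcong_def m_ac cancel)

end

lemma bcong_carrier: "bcong I x y \<Longrightarrow> x \<in> carrier P" "bcong I x y \<Longrightarrow> y \<in> carrier P"
  by (auto simp: bcong_def)

text \<open>By \<open>mult_star_expand\<close> the two sides differ by
  \<open>x \<star> (j \<star> y) \<otimes> j \<star> y\<close> with \<open>j \<in> J\<close>. Used
  with \<open>J = I\<close> and with \<open>J = ann I\<close>.\<close>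

lemma mult_star_bcong:
  assumes I: "star_ideal I" and J: "subgroup J P" "\<And>z y. z \<in> J \<Longrightarrow> y \<in> carrier P \<Longrightarrow> z \<star> y \<in> I"
    and t: "t \<in> J" "inv\<^bsub>M\<^esub> x \<star> t \<in> J" and x: "x \<in> carrier P" "y \<in> carrier P"
  shows "bcong I ((x \<otimes> t) \<star> y) (x \<star> y)"
proof -
  have t': "t \<in> carrier P" using J t subgroup.mem_carrier by metis
  let ?j = "t \<otimes> inv\<^bsub>M\<^esub> x \<star> t"
  have "?j \<in> J" using t J by (auto intro: subgroup.m_closed)
  then have j: "?j \<star> y \<in> I" "?j \<star> y \<in> carrier P" using J x t' by auto
  then have "x \<star> (?j \<star> y) \<otimes> ?j \<star> y \<in> I" using I x by (auto intro: star_idealD)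
  then have "bcong I (x \<star> y \<otimes> (x \<star> (?j \<star> y) \<otimes> ?j \<star> y)) (x \<star> y)"
    using I x by (intro bcong_mult_right) (auto simp: star_idealD)
  moreover have "(x \<otimes> t) \<star> y = x \<star> y \<otimes> (x \<star> (?j \<star> y) \<otimes> ?j \<star> y)"
      unfolding mult_star_expand[OF x(1) t' x(2)] using x t' j(2) by (simp add: m_ac)
  ultimately show ?thesis by (simp only:)
qed

lemma star_bcong_left:
  assumes I: "star_ideal I" and "bcong I x x'" "y \<in> carrier P"
  shows "bcong I (x \<star> y) (x' \<star> y)"
proof -
  note I' = star_idealD[OF I]
  obtain i where i: "i \<in> I" "x = x' \<otimes> i" using bcongE[OF I'(1) assms(2)] .
  have "x' \<in> carrier P" using assms by (simp add: bcong_carrier)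
  then show ?thesis using mult_star_bcong[OF I I'(1), of i x' y] I' i assms by simp
qed

lemma star_bcong_right:
  assumes I: "star_ideal I" and "bcong I y y'" "x \<in> carrier P"
  shows "bcong I (x \<star> y) (x \<star> y')"
proof -
  note I' = star_idealD[OF I]
  obtain i where i: "i \<in> I" "y = y' \<otimes> i" using bcongE[OF I'(1) assms(2)] .
  have "y' \<in> carrier P" "x \<star> i \<in> I" "i \<in> carrier P" using assms i by (auto simp: bcong_carrier I')
  then show ?thesis using assms i bcong_mult_right[OF I'(1), of "x \<star> y'" "x \<star> i"] by (simp add: star_mult)
qed

lemma star_bcong: "star_ideal I \<Longrightarrow> bcong I x x' \<Longrightarrow> bcong I y y' \<Longrightarrow> bcong I (x \<star> y) (x' \<star> y')"
  by (meson bcong_carrier bcong_trans star_bcong_left star_bcong_right star_idealD(1))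

text \<open>As \<open>ann I\<close> is not yet known to be a subgroup, it cannot serve as
  \<open>J\<close> in \<open>mult_star_bcong\<close>. Instead \<open>j\<close> in the expansion is
  congruent to \<open>b\<close> modulo \<open>I\<close>.\<close>

lemma ann_mult_closed:
  assumes I: "star_ideal I" and a: "a \<in> ann I" and b: "b \<in> ann I" and y: "y \<in> carrier P"
  shows "(a \<otimes> b) \<star> y \<in> I"
proof -
  note I' = star_idealD[OF I]
  have [simp]: "a \<in> carrier P" "b \<in> carrier P" "y \<in> carrier P" using a b y by (auto simp: ann_def)
  let ?j = "b \<otimes> inv\<^bsub>M\<^esub> a \<star> b"
  have "inv\<^bsub>M\<^esub> a \<star> b \<in> I" using b by (simp add: ann_def)
  then have "bcong I ?j b" by (intro bcong_mult_right[OF I'(1)]) auto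
  then have "bcong I (?j \<star> y) (b \<star> y)" by (intro star_bcong_left[OF I]) auto
  then have j: "?j \<star> y \<in> I" using bcong_mem[OF I'(1)] b y by (auto simp: ann_def)
  have "a \<star> y \<in> I" using a y by (auto simp: ann_def)
  then show ?thesis unfolding mult_star_expand[OF \<open>a \<in> carrier P\<close> \<open>b \<in> carrier P\<close> \<open>y \<in> carrier P\<close>] using j by (simp add: I')
qed

lemma ann_star_ideal:
  assumes I: "star_ideal I" shows "star_ideal (ann I)" "I \<subseteq> ann I"
proof -
  note I' = star_idealD[OF I]
  show sub: "I \<subseteq> ann I" using I' by (auto simp: ann_def)
  have "subgroup (ann I) P"
  proof (rule subgroupI)
    show "ann I \<subseteq> carrier P" by (auto simp: ann_def)
    show "ann I \<noteq> {}" using sub I' by auto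
    fix a b assume a: "a \<in> ann I" and b: "b \<in> ann I"
    then have [simp]: "a \<in> carrier P" "b \<in> carrier P" by (auto simp: ann_def)
    show "a \<otimes> b \<in> ann I"
      using ann_mult_closed[OF I a b] a b by (auto simp: ann_def star_mult I')
    have "inv a \<star> x \<in> I" if [simp]: "x \<in> carrier P" for x
    proof -
      \<comment> \<open>Expanding \<open>(a \<otimes> inv a) \<star> x\<close>, which is
        \<open>\<one>\<close>, shows that \<open>?j \<star> x\<close> is in \<open>I\<close>; and
        \<open>?j\<close> is congruent to \<open>inv a\<close> modulo \<open>I\<close>.\<close>
      let ?j = "inv a \<otimes> inv\<^bsub>M\<^esub> a \<star> inv a"
      have 1: "\<one> = a \<star> (?j \<star> x) \<otimes> a \<star> x \<otimes> ?j \<star> x"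
        using mult_star_expand[of a "inv a" x] by simp
      have 2: "a \<star> (?j \<star> x) \<otimes> a \<star> x \<in> I" using a by (auto simp: ann_def I')
      have "?j \<star> x = inv (a \<star> (?j \<star> x) \<otimes> a \<star> x)"
        using 1[symmetric] by (intro inv_equality[symmetric]) (auto simp: m_ac)
      then have 3: "?j \<star> x \<in> I" by (rule ssubst) (rule I'(4)[OF 2])
      have "inv\<^bsub>M\<^esub> a \<star> inv a \<in> I" using a by (auto simp: star_inv I' ann_def)
      then have "bcong I ?j (inv a)" by (intro bcong_mult_right[OF I'(1)]) auto
      then have "bcong I (inv a \<star> x) (?j \<star> x)" by (rule bcong_sym[OF I'(1) star_bcong_left[OF I]]) simp
      then show ?thesis using 3 bcong_mem[OF I'(1)] by auto
    qed
    then show "inv a \<in> ann I" using a by (auto simp: ann_def star_inv I')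
  qed
  then show "star_ideal (ann I)" using sub by (auto simp: star_ideal_def ann_def)
qed

text \<open>For \<open>I = zeta P M i\<close> this sharpens a congruence by one level of the central
  series; the approximation arguments below rest on it.\<close>

lemma star_bcong_ann:
  assumes I: "star_ideal I" and "bcong (ann I) x x'" and y: "y \<in> carrier P"
  shows "bcong I (x \<star> y) (x' \<star> y)" "bcong I (y \<star> x) (y \<star> x')"
proof -
  note I' = star_idealD[OF I] and A = ann_star_ideal[OF I]
  note A' = star_idealD[OF A(1)]
  obtain i where i: "i \<in> ann I" "x = x' \<otimes> i" using bcongE[OF A'(1) assms(2)] .
  have [simp]: "x' \<in> carrier P" "i \<in> carrier P" using assms i by (auto simp: bcong_carrier ann_def)
  show "bcong I (x \<star> y) (x' \<star> y)"
    unfolding i(2) by (rule mult_star_bcong[OF I A'(1) _ i(1)]) (use i y A'(6) in \<open>auto simp: ann_def\<close>)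
  have "y \<star> i \<in> I" using i y by (auto simp: ann_def)
  then show "bcong I (y \<star> x) (y \<star> x')"
    using i y bcong_mult_right[OF I'(1), of "y \<star> x'" "y \<star> i"] by (simp add: star_mult)
qed

lemma star_ideal_one: "star_ideal {\<one>}"
  by (simp add: star_ideal_def triv_subgroup)

lemma zeta_star_ideal: "star_ideal (zeta P M n)"
  by (induction n) (simp_all add: star_ideal_one ann_star_ideal zeta_Suc_ann del: zeta.simps(2))

lemma zeta_mono: "m \<le> n \<Longrightarrow> zeta P M m \<subseteq> zeta P M n"
proof (induction rule: dec_induct)
  case (step n)
  then show ?case
    using ann_star_ideal(2)[OF zeta_star_ideal[of n]] unfolding zeta_Suc_ann by blast
qed simp

section \<open>Star products of multiples of an element\<close>

lemma pow_add_one: "x \<in> carrier P \<Longrightarrow> x [^] (n + 1 :: int) = x \<otimes> x [^] n"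
  using int_pow_mult[of x 1 n] by (simp add: add.commute)

text \<open>A substitute for additivity on the left. As \<open>c \<star> c\<close> is in
  \<open>ann I\<close>, the sum of \<open>c\<close> and \<open>mc\<close> may be replaced by their
  \<open>M\<close>-product; \<open>M_mult_star\<close> then adds only
  \<open>c \<star> (mc \<star> y)\<close>, which vanishes modulo \<open>I\<close> because
  \<open>c \<star> (c \<star> y)\<close> does.\<close>

lemma pow_star_bcong:
  assumes I: "star_ideal I" and c: "c \<in> carrier P" "c \<star> c \<in> ann I"
    and y: "y \<in> carrier P" "c \<star> (c \<star> y) \<in> I"
  shows "bcong I ((c [^] (n::int)) \<star> y) ((c \<star> y) [^] n)"
proof -
  note I' = star_idealD[OF I] and A = star_idealD[OF ann_star_ideal(1)[OF I]]
  have step: "bcong I ((c [^] (m + 1)) \<star> y) (c \<star> (c [^] m \<star> y) \<otimes> c \<star> y \<otimes> c [^] m \<star> y)" for m :: int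
  proof -
    have "c \<star> c [^] m \<in> ann I" using c by (simp add: star_pow star_ideal_pow ann_star_ideal I)
    then have "bcong (ann I) (c \<otimes> c [^] m \<otimes> c \<star> c [^] m) (c \<otimes> c [^] m)"
      using c by (intro bcong_mult_right[OF A(1)]) auto
    then have "bcong (ann I) (c [^] (m + 1)) (c \<otimes>\<^bsub>M\<^esub> c [^] m)"
      using c bcong_sym[OF A(1)] by (simp add: M_mult_eq pow_add_one)
    from star_bcong_ann(1)[OF I this y(1)] show ?thesis using c y by (simp add: M_mult_star)
  qed
  have cy: "bcong I (c \<star> (c \<star> y) [^] m) \<one>" for m :: int
    using c y by (simp add: star_pow bcong_one_iff I' star_ideal_pow I)
  show ?thesis
  proof (induction n rule: int_induct[where k = 0])
    case base
    then show ?case using c y by (simp add: bcong_refl I')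
  next
    case (step1 m)
    have "bcong I (c \<star> (c [^] m \<star> y)) \<one>"
      using bcong_trans[OF I'(1) star_bcong_right[OF I step1(2) c(1)] cy] .
    then have "bcong I (c \<star> (c [^] m \<star> y) \<otimes> c \<star> y \<otimes> c [^] m \<star> y) (\<one> \<otimes> c \<star> y \<otimes> (c \<star> y) [^] m)"
      using c y step1 by (intro bcong_mult[OF I'(1)] bcong_refl[OF I'(1)]) simp_all
    from bcong_trans[OF I'(1) step this] show ?case using c y by (simp add: pow_add_one)
  next
    case (step2 m)
    have [simp]: "c \<in> carrier P" "y \<in> carrier P" using c y by auto
    have alg: "a \<otimes> b \<otimes> d \<otimes> inv b = a \<otimes> d" if "a \<in> carrier P" "b \<in> carrier P" "d \<in> carrier P" for a b d
      using that by (simp add: m_ac cancel)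
    \<comment> \<open>Downwards, the recursion has to be solved for \<open>?u\<close>. The error
      \<open>?w\<close> satisfies \<open>c \<star> ?w \<otimes> ?w \<in> I\<close>, and
      \<open>star_recover\<close> puts \<open>?w\<close> itself in \<open>I\<close>.\<close>
    let ?u = "c [^] (m - 1) \<star> y" and ?v = "(c \<star> y) [^] (m - 1)"
    let ?w = "?u \<otimes> inv ?v"
    have "bcong I (c \<star> ?u \<otimes> c \<star> y \<otimes> ?u) (c \<star> y \<otimes> ?v)"
      using bcong_trans[OF I'(1) bcong_sym[OF I'(1) step[of "m - 1"]]] step2(2) pow_add_one[of "c \<star> y" "m - 1"] by simp
    then have "bcong I (c \<star> ?u \<otimes> c \<star> y \<otimes> ?u \<otimes> inv (c \<star> y)) (c \<star> y \<otimes> ?v \<otimes> inv (c \<star> y))"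
      by (rule bcong_mult[OF I'(1) _ bcong_refl[OF I'(1)]]) auto
    moreover have "c \<star> ?u \<otimes> c \<star> y \<otimes> ?u \<otimes> inv (c \<star> y) = c \<star> ?u \<otimes> ?u"
      by (rule alg(1)) simp_all
    moreover have "c \<star> y \<otimes> ?v \<otimes> inv (c \<star> y) = ?v" by (simp add: m_ac cancel)
    ultimately have "bcong I (c \<star> ?u \<otimes> ?u) ?v" by simp
    moreover have "bcong I (c \<star> inv ?v) \<one>" using cy[of "1 - m"] int_pow_neg[of "c \<star> y" "m - 1"] by simp
    ultimately have "bcong I (c \<star> ?u \<otimes> ?u \<otimes> (c \<star> inv ?v \<otimes> inv ?v)) (?v \<otimes> (\<one> \<otimes> inv ?v))"
      by (intro bcong_mult[OF I'(1)] bcong_refl[OF I'(1)]) simp_all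
    then have 1: "c \<star> ?w \<otimes> ?w \<in> I" by (simp add: star_mult m_ac bcong_one_iff[OF I'(1)])
    have w [simp]: "?w \<in> carrier P" by simp
    have "inv\<^bsub>M\<^esub> c \<star> (c \<star> ?w \<otimes> ?w) \<otimes> (c \<star> ?w \<otimes> ?w) \<in> I" using 1 by (simp add: I')
    with star_recover[OF \<open>c \<in> carrier P\<close> w] have "?w \<in> I" by (rule ssubst)
    then show ?case by (simp add: bcong_def)
  qed
qed

end

section \<open>Subbraces of a nilpotent T-brace are ideals\<close>

context left_brace
begin

lemma bcong_triv: "bcong {\<one>} x y \<Longrightarrow> x = y"
  by (auto simp: bcong_def inv_solve_right' dest: sym)

lemma zeta_carrier: "x \<in> zeta P M n \<Longrightarrow> x \<in> carrier P"
  using star_idealD(3)[OF zeta_star_ideal] .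

text \<open>Nilpotency serves to obtain \<open>M\<close>-inverses. The \<open>M\<close>-inverse
  \<open>w\<close> of \<open>z\<close> satisfies \<open>w = - z - z \<star> w\<close> additively;
  inserting an approximation of \<open>w\<close> from \<open>L\<close> on the right gains one level
  of the central series.\<close>

lemma star_closed_subbrace:
  assumes nil: "zeta P M k = carrier P" and L: "subgroup L P"
    and star: "\<And>x y. x \<in> L \<Longrightarrow> y \<in> L \<Longrightarrow> x \<star> y \<in> L"
  shows "subbrace P M L"
proof -
  have LP: "x \<in> carrier P" if "x \<in> L" for x using subgroup.mem_carrier[OF L that] .
  have "subgroup L M"
  proof (rule group.subgroupI[OF group_M])
    show "L \<subseteq> carrier M" "L \<noteq> {}" using LP subgroup.one_closed[OF L] by auto
    fix z assume z: "z \<in> L"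
    show "z \<otimes>\<^bsub>M\<^esub> y \<in> L" if "y \<in> L" for y
      using z that LP by (simp add: M_mult_eq star subgroup.m_closed[OF L])
    let ?w = "inv\<^bsub>M\<^esub> z"
    have [simp]: "z \<in> carrier P" using LP z by simp
    have "z \<otimes>\<^bsub>M\<^esub> ?w = \<one>" using group.r_inv[OF group_M, of z] by (simp add: one_M)
    then have "?w \<otimes> (z \<otimes> z \<star> ?w) = \<one>" by (simp add: M_mult_eq m_ac)
    then have w: "?w = inv z \<otimes> inv (z \<star> ?w)"
      using inv_equality[of ?w "z \<otimes> z \<star> ?w"] by (simp add: inv_mult)
    have "\<exists>l\<in>L. bcong (zeta P M 0) ?w l"
    proof (rule inc_induct[of 0 k])
      show "\<exists>l\<in>L. bcong (zeta P M k) ?w l"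
        using subgroup.one_closed[OF L] by (intro bexI[of _ \<one>]) (simp_all add: nil bcong_def)
      fix i assume "\<exists>l\<in>L. bcong (zeta P M (Suc i)) ?w l"
      then obtain l where l: "l \<in> L" "bcong (ann (zeta P M i)) ?w l" by (auto simp: zeta_Suc_ann simp del: zeta.simps)
      note I = zeta_star_ideal[of i]
      note S = star_idealD(1)[OF I]
      have "bcong (zeta P M i) (inv z \<otimes> inv (z \<star> ?w)) (inv z \<otimes> inv (z \<star> l))"
        by (intro bcong_mult[OF S] bcong_inv[OF S] bcong_refl[OF S] star_bcong_ann(2)[OF I l(2)]) simp_all
      moreover have "inv z \<otimes> inv (z \<star> l) \<in> L"
        using z l by (intro subgroup.m_closed[OF L] subgroup.m_inv_closed[OF L] star)
      ultimately show "\<exists>l\<in>L. bcong (zeta P M i) ?w l" by (auto simp flip: w)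
    qed simp
    then show "?w \<in> L" using bcong_triv by auto
  qed
  then show ?thesis using L by (simp add: subbrace_def)
qed

text \<open>A subbrace \<open>L\<close> is an ideal because each \<open>L + \<zeta>\<^sub>i\<close> is an ideal of \<open>L + \<zeta>\<^sub>i\<^sub>+\<^sub>1\<close>.\<close>

lemma T_brace_star_closed:
  assumes T: "T_brace P M" and nil: "zeta P M k = carrier P" and L: "subgroup L P"
    and star: "\<And>x y. x \<in> L \<Longrightarrow> y \<in> L \<Longrightarrow> x \<star> y \<in> L"
  shows "star_ideal L"
proof -
  have LP: "x \<in> carrier P" if "x \<in> L" for x using subgroup.mem_carrier[OF L that] .
  define N where "N i = {x. \<exists>l\<in>L. bcong (zeta P M i) x l}" for i
  have NI: "x \<in> N i" if "l \<in> L" "bcong (zeta P M i) x l" for i x l using that by (auto simp: N_def)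
  \<comment> \<open>Replacing \<open>a\<close> by an element of \<open>L\<close> modulo level
    \<open>Suc i\<close>, and \<open>x\<close> by one modulo level \<open>i\<close>, changes the
    products only modulo level \<open>i\<close>.\<close>
  have N_star: "a \<star> x \<in> N i \<and> x \<star> a \<in> N i" if a: "a \<in> N (Suc i)" and x: "x \<in> N i" for a x i
  proof -
    note I = zeta_star_ideal[of i]
    note S = star_idealD(1)[OF I]
    obtain l where l: "l \<in> L" "bcong (ann (zeta P M i)) a l"
      using a by (auto simp: N_def zeta_Suc_ann simp del: zeta.simps)
    obtain l' where l': "l' \<in> L" "bcong (zeta P M i) x l'"
      using x by (auto simp: N_def)
    note c = bcong_carrier[OF l(2)] bcong_carrier[OF l'(2)]
    have "bcong (zeta P M i) (a \<star> x) (l \<star> l')"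
      by (rule bcong_trans[OF S star_bcong_ann(1)[OF I l(2) c(3)] star_bcong_right[OF I l'(2) c(2)]])
    moreover have "bcong (zeta P M i) (x \<star> a) (l' \<star> l)"
      by (rule bcong_trans[OF S star_bcong_ann(2)[OF I l(2) c(3)] star_bcong_left[OF I l'(2) c(2)]])
    ultimately show ?thesis using l l' star by (meson NI)
  qed
  have N_mono: "N i \<subseteq> N (Suc i)" for i
    using zeta_mono[of i "Suc i"] unfolding N_def bcong_def by (auto simp del: zeta.simps)
  have N_sub: "subgroup (N i) P" for i
  proof (rule subgroupI)
    note S = star_idealD(1)[OF zeta_star_ideal[of i]]
    show "N i \<subseteq> carrier P" by (auto simp: N_def bcong_def)
    show "N i \<noteq> {}" using NI[OF subgroup.one_closed[OF L], of i \<one>] bcong_refl[OF S] by auto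
    fix a b assume a: "a \<in> N i" and b: "b \<in> N i"
    from a show "inv a \<in> N i"
      using bcong_inv[OF S] subgroup.m_inv_closed[OF L] unfolding N_def by blast
    from a b show "a \<otimes> b \<in> N i"
      using bcong_mult[OF S] subgroup.m_closed[OF L] unfolding N_def by blast
  qed
  have N_subbrace: "subbrace P M (N i)" for i
    by (rule star_closed_subbrace[OF nil N_sub]) (use N_star N_mono in blast)
  have "brace_ideal P M (N 0)"
  proof (rule inc_induct[of 0 k])
    have "N k = carrier P"
    proof
      show "carrier P \<subseteq> N k"
        using subgroup.one_closed[OF L] by (auto intro!: NI[of \<one>] simp: nil bcong_def)
    qed (auto simp: N_def bcong_def)
    then show "brace_ideal P M (N k)"
      using N_subbrace[of k] by (simp add: brace_ideal_def brace_ideal_in_def)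
    fix i assume "brace_ideal P M (N (Suc i))"
    moreover have "brace_ideal_in P M (N i) (N (Suc i))"
      using N_subbrace N_mono N_star by (auto simp: brace_ideal_in_def)
    ultimately show "brace_ideal P M (N i)"
      using T N_subbrace unfolding T_brace_def by blast
  qed simp
  moreover have "N 0 = L"
  proof
    show "N 0 \<subseteq> L" using bcong_triv by (auto simp: N_def)
    show "L \<subseteq> N 0" using NI[of _ 0] LP bcong_refl[OF star_idealD(1)[OF star_ideal_one]] by auto
  qed
  ultimately show ?thesis
    by (auto simp: star_ideal_def brace_ideal_def brace_ideal_in_def subbrace_def)
qed

section \<open>Ideals generated by one element\<close>

definition gen where "gen a = \<Inter>{L. star_ideal L \<and> a \<in> L}"

lemma star_ideal_carrier: "star_ideal (carrier P)"
  by (simp add: star_ideal_def subgroup_self)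

lemma gen_star_ideal: assumes "a \<in> carrier P" shows "star_ideal (gen a)"
proof -
  have "subgroup (gen a) P" unfolding gen_def
    using assms star_ideal_carrier by (intro subgroups_Inter) (auto simp: star_ideal_def)
  then show ?thesis
    unfolding star_ideal_def[of "gen a"] by (auto simp: gen_def star_idealD)
qed

lemma gen_self: "a \<in> gen a"
  by (simp add: gen_def)

lemma gen_least: "star_ideal L \<Longrightarrow> a \<in> L \<Longrightarrow> gen a \<subseteq> L"
  by (auto simp: gen_def)

lemma gen_subset: "b \<in> carrier P \<Longrightarrow> a \<in> gen b \<Longrightarrow> gen a \<subseteq> gen b"
  by (rule gen_least[OF gen_star_ideal])

lemma gen_star_self_subset: "a \<in> carrier P \<Longrightarrow> gen (a \<star> a) \<subseteq> gen a"
  by (intro gen_subset star_idealD(6)[OF gen_star_ideal] gen_self)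

end

text \<open>From here on the T-property enters through \<open>dedekind\<close>, the conclusion of
  \<open>T_brace_star_closed\<close>.\<close>

locale dedekind_brace = left_brace +
  fixes k :: nat
  assumes nil: "zeta P M k = carrier P"
    and dedekind: "subgroup L P \<Longrightarrow> (\<And>x y. x \<in> L \<Longrightarrow> y \<in> L \<Longrightarrow> x \<star> y \<in> L) \<Longrightarrow> star_ideal L"
begin

text \<open>Additively, \<open>gen a = \<int>a + gen (a \<star> a)\<close>.\<close>

lemma gen_cases:
  assumes a: "a \<in> carrier P" and x: "x \<in> gen a"
  obtains n :: int where "bcong (gen (a \<star> a)) x (a [^] n)"
proof -
  let ?I = "gen (a \<star> a)"
  have I: "star_ideal ?I" using a by (simp add: gen_star_ideal)
  note S = star_idealD(1)[OF I] and A = ann_star_ideal[OF I]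
  define L where "L = {x. \<exists>n::int. bcong ?I x (a [^] n)}"
  have LI: "x \<in> L" if "bcong ?I x (a [^] n)" for x and n :: int using that by (auto simp: L_def)
  have "subgroup L P"
  proof (rule subgroupI)
    show "L \<subseteq> carrier P" by (auto simp: L_def bcong_def)
    show "L \<noteq> {}" using LI[of \<one> 0] bcong_refl[OF S] by auto
    fix x assume "x \<in> L"
    then obtain n :: int where n: "bcong ?I x (a [^] n)" by (auto simp: L_def)
    show "inv x \<in> L" using bcong_inv[OF S n] LI[of "inv x" "- n"] a by (simp add: int_pow_neg)
    fix y assume "y \<in> L"
    then obtain m :: int where m: "bcong ?I y (a [^] m)" by (auto simp: L_def)
    show "x \<otimes> y \<in> L" using bcong_mult[OF S n m] LI[of "x \<otimes> y" "n + m"] a by (simp add: int_pow_mult)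
  qed
  moreover have "x \<star> y \<in> L" if xy: "x \<in> L" "y \<in> L" for x y
  proof -
    obtain n m :: int where n: "bcong ?I x (a [^] n)" and m: "bcong ?I y (a [^] m)"
      using xy by (auto simp: L_def)
    have aa: "a \<star> a \<in> ?I" by (rule gen_self)
    \<comment> \<open>Multiples of \<open>a\<close> have star products in \<open>?I\<close>, because
      \<open>a \<star> a\<close> lies in \<open>?I\<close> and hence in
      \<open>ann ?I\<close>.\<close>
    have "bcong ?I (a [^] n \<star> a) ((a \<star> a) [^] n)"
      using a aa A by (intro pow_star_bcong I) (auto simp: star_idealD(6)[OF I])
    then have "a [^] n \<star> a \<in> ?I"
      using bcong_mem[OF S] star_ideal_pow[OF I aa] by blast
    then have "a [^] n \<star> a [^] m \<in> ?I" using a by (simp add: star_pow star_ideal_pow[OF I])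
    with star_bcong[OF I n m] have "x \<star> y \<in> ?I" using bcong_mem[OF S] by blast
    then show ?thesis using LI[of _ 0] by (simp add: bcong_one_iff[OF S])
  qed
  ultimately have "star_ideal L" by (rule dedekind)
  moreover have "a \<in> L" using LI[of a 1] bcong_refl[OF S] a by simp
  ultimately have "x \<in> L" using x gen_least by blast
  then show ?thesis using that by (auto simp: L_def)
qed

text \<open>Modulo \<open>I\<close>, \<open>f\<close> multiplies multiples of \<open>a\<close> by
  \<open>n\<close>; it also lowers the level in the central series, so \<open>k\<close> applications
  leave only \<open>\<one>\<close>.\<close>

lemma nilpotent_scalar:
  assumes I: "star_ideal I"
    and f: "\<And>i x. x \<in> zeta P M (Suc i) \<Longrightarrow> f x \<in> zeta P M i"
      "\<And>x x'. bcong I x x' \<Longrightarrow> bcong I (f x) (f x')"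
      "\<And>m::int. bcong I (f (a [^] m)) (a [^] (n * m))"
    and a: "a \<in> carrier P"
  shows "a [^] ((n::int) ^ k) \<in> I"
proof -
  note S = star_idealD(1)[OF I]
  have "\<exists>x\<in>zeta P M 0. bcong I (a [^] (n ^ (k - 0))) x"
  proof (rule inc_induct[of 0 k])
    show "\<exists>x\<in>zeta P M k. bcong I (a [^] (n ^ (k - k))) x" using a by (auto simp: nil intro: bcong_refl[OF S])
    fix i assume "i < k" and "\<exists>x\<in>zeta P M (Suc i). bcong I (a [^] (n ^ (k - Suc i))) x"
    then obtain x where x: "x \<in> zeta P M (Suc i)" "bcong I (a [^] (n ^ (k - Suc i))) x" by blast
    have "bcong I (a [^] (n * n ^ (k - Suc i))) (f x)"
      using bcong_trans[OF S bcong_sym[OF S f(3)] f(2)[OF x(2)]] .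
    then show "\<exists>x\<in>zeta P M i. bcong I (a [^] (n ^ (k - i))) x"
      using f(1)[OF x(1)] \<open>i < k\<close> by (auto simp flip: power_Suc simp: Suc_diff_Suc)
  qed simp
  then show ?thesis by (simp add: bcong_one_iff[OF S])
qed

text \<open>Modulo \<open>gen (a \<star> a)\<close> both \<open>y \<star> a\<close> and \<open>a \<star> y\<close> are multiples of \<open>a\<close>; by nilpotency
the coefficient is nilpotent in \<open>\<int>\<close>, hence zero.\<close>

lemma ann_gen_infinite:
  assumes a: "a \<in> carrier P" and inf: "\<And>n::int. a [^] n \<in> gen (a \<star> a) \<Longrightarrow> n = 0"
  shows "a \<in> ann (gen (a \<star> a))"
proof -
  let ?I = "gen (a \<star> a)"
  have I: "star_ideal ?I" using a by (simp add: gen_star_ideal)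
  note S = star_idealD(1)[OF I] and A = ann_star_ideal[OF I]
  have aa: "a \<star> a \<in> ?I" by (rule gen_self)
  have "y \<star> a \<in> ?I \<and> a \<star> y \<in> ?I" if y: "y \<in> carrier P" for y
  proof
    have ga: "y \<star> a \<in> gen a" "a \<star> y \<in> gen a"
      using star_idealD(6,7)[OF gen_star_ideal[OF a] y gen_self] by auto
    obtain n :: int where n: "bcong ?I (y \<star> a) (a [^] n)" using gen_cases[OF a ga(1)] .
    have "a [^] (n ^ k) \<in> ?I"
    proof (rule nilpotent_scalar[where f = "\<lambda>x. y \<star> x", OF I _ _ _ a])
      fix m :: int
      have "bcong ?I ((y \<star> a) [^] m) ((a [^] n) [^] m)" by (rule bcong_pow[OF S n])
      then show "bcong ?I (y \<star> a [^] m) (a [^] (n * m))"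
        using a y by (simp add: star_pow int_pow_pow)
    qed (use y star_bcong_right[OF I] in auto)
    then have "n = 0" using inf by fastforce
    then show "y \<star> a \<in> ?I" using n by (simp add: bcong_one_iff[OF S])
    obtain n :: int where n: "bcong ?I (a \<star> y) (a [^] n)" using gen_cases[OF a ga(2)] .
    \<comment> \<open>The map \<open>x \<mapsto> x \<star> y\<close> need not be additive. This
      provides the hypothesis under which \<open>pow_star_bcong\<close> makes it additive on
      multiples of \<open>a\<close> modulo \<open>?I\<close>.\<close>
    have "bcong ?I (a \<star> (a \<star> y)) (a \<star> a [^] n)" by (rule star_bcong_right[OF I n a])
    moreover have "a \<star> a [^] n \<in> ?I" using a by (simp add: star_pow star_ideal_pow[OF I aa])
    ultimately have aay: "a \<star> (a \<star> y) \<in> ?I" using bcong_mem[OF S] by blast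
    have "a [^] (n ^ k) \<in> ?I"
    proof (rule nilpotent_scalar[where f = "\<lambda>x. x \<star> y", OF I _ _ _ a])
      fix m :: int
      have "bcong ?I (a [^] m \<star> y) ((a \<star> y) [^] m)"
        using A aa aay by (intro pow_star_bcong I a y) auto
      from bcong_trans[OF S this bcong_pow[OF S n]]
      show "bcong ?I (a [^] m \<star> y) (a [^] (n * m))"
        using a y by (simp add: star_pow int_pow_pow)
    qed (use y star_bcong_left[OF I] in auto)
    then have "n = 0" using inf by fastforce
    then show "a \<star> y \<in> ?I" using n by (simp add: bcong_one_iff[OF S])
  qed
  then show ?thesis using a by (auto simp: ann_def)
qed

text \<open>Finite order modulo \<open>gen (a \<star> a)\<close> passes from \<open>a\<close> to
  \<open>c = a \<star> a\<close>, now modulo \<open>gen (c \<star> c)\<close>. Since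
  \<open>c\<close> lies one level lower, induction applies, and the exponents multiply.\<close>

lemma gen_bounded:
  assumes "a \<in> carrier P" "n \<noteq> 0" "a [^] (n::int) \<in> gen (a \<star> a)"
  shows "\<exists>e::int. e \<noteq> 0 \<and> (\<forall>x\<in>gen a. x [^] e = \<one>)"
proof -
  have "\<exists>e::int. e \<noteq> 0 \<and> (\<forall>x\<in>gen a. x [^] e = \<one>)"
    if "a \<in> zeta P M i" "n \<noteq> 0" "a [^] (n::int) \<in> gen (a \<star> a)" for i a n
    using that
  proof (induction i arbitrary: a n)
    case 0
    then have "gen a \<subseteq> {\<one>}" by (intro gen_least star_ideal_one) simp
    then show ?case by (intro exI[of _ 1]) auto
  next
    case (Suc i)
    have a: "a \<in> carrier P" using Suc.prems zeta_carrier by blast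
    define c where "c = a \<star> a"
    have c: "c \<in> zeta P M i" "c \<in> carrier P" using Suc.prems a by (auto simp: c_def)
    have "\<exists>m::int. m \<noteq> 0 \<and> c [^] m \<in> gen (c \<star> c)"
    proof (rule ccontr)
      \<comment> \<open>Otherwise \<open>ann_gen_infinite\<close> applies to \<open>c\<close>, so
        \<open>a \<star> c\<close> vanishes modulo \<open>?I\<close>. With \<open>na\<close>
        congruent to \<open>mc\<close>, also \<open>nc = a \<star> na\<close> vanishes modulo
        \<open>?I\<close>.\<close>
      assume *: "\<nexists>m::int. m \<noteq> 0 \<and> c [^] m \<in> gen (c \<star> c)"
      let ?I = "gen (c \<star> c)"
      have I: "star_ideal ?I" using c by (simp add: gen_star_ideal)
      note S = star_idealD(1)[OF I]
      have "c \<in> ann ?I" using ann_gen_infinite c * by blast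
      then have ac: "a \<star> c \<in> ?I" using a by (simp add: ann_def)
      obtain m :: int where m: "bcong ?I (a [^] n) (c [^] m)"
        using gen_cases[OF c(2)] Suc.prems(3) by (auto simp: c_def)
      have "a \<star> c [^] m \<in> ?I" using a c ac by (simp add: star_pow star_ideal_pow[OF I])
      then have "a \<star> a [^] n \<in> ?I" using bcong_mem[OF S star_bcong_right[OF I m a]] by simp
      then have "c [^] n \<in> ?I" using a by (simp add: star_pow c_def)
      with * Suc.prems show False by blast
    qed
    then obtain e :: int where e: "e \<noteq> 0" "\<forall>x\<in>gen c. x [^] e = \<one>" using Suc.IH[OF c(1)] by blast
    have "x [^] (n * e) = \<one>" if x: "x \<in> gen a" for x
    proof -
      have C: "star_ideal (gen c)" by (rule gen_star_ideal[OF c(2)])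
      obtain t :: int where "bcong (gen c) x (a [^] t)" using gen_cases[OF a x] by (auto simp: c_def)
      then obtain j where j: "j \<in> gen c" "x = a [^] t \<otimes> j" using bcongE[OF star_idealD(1)[OF C]] by blast
      then have "j [^] e = \<one>" "j \<in> carrier P" "(a [^] n) [^] e = \<one>"
        using e Suc.prems star_idealD(3)[OF C] by (auto simp: c_def)
      moreover have "x [^] (n * e) = ((a [^] n) [^] e) [^] t \<otimes> (j [^] e) [^] n"
        using a \<open>j \<in> carrier P\<close> by (simp add: j(2) int_pow_distrib int_pow_pow mult.commute mult.left_commute)
      ultimately show ?thesis by simp
    qed
    then show ?case using e Suc.prems by (intro exI[of _ "n * e"]) auto
  qed
  from this[of a k] show ?thesis using assms nil by simp
qed

end

section \<open>Central elements of infinite order and their consequences\<close>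

locale nonperiodic_dedekind_brace = dedekind_brace +
  assumes nonperiodic: "\<not> periodic_group P"
begin

lemma ex_infinite: "\<exists>b\<in>carrier P. \<forall>n::int. b [^] n = \<one> \<longrightarrow> n = 0"
proof -
  obtain b where b: "b \<in> carrier P" "\<And>n::nat. n > 0 \<Longrightarrow> b [^] n \<noteq> \<one>"
    using nonperiodic unfolding periodic_group_def by blast
  have "n = 0" if "b [^] n = \<one>" for n :: int
  proof (rule ccontr)
    assume "n \<noteq> 0"
    moreover have "b [^] \<bar>n\<bar> = \<one>" using that b by (simp add: abs_if int_pow_neg)
    then have "b [^] nat \<bar>n\<bar> = \<one>" by (metis abs_ge_zero int_pow_int nat_0_le)
    ultimately show False using b(2)[of "nat \<bar>n\<bar>"] by simp
  qed
  then show ?thesis using b by blast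
qed

text \<open>Take \<open>b\<close> of infinite order on the lowest possible level. Then
  \<open>b \<star> b\<close> has finite order, so some \<open>e \<noteq> 0\<close> kills
  \<open>gen (b \<star> b)\<close>, which contains all star products with \<open>b\<close>. A
  multiple of \<open>b\<close> by a power of \<open>e\<close> is central.\<close>

lemma ex_central_infinite: "\<exists>z\<in>ann {\<one>}. \<forall>n::int. z [^] n = \<one> \<longrightarrow> n = 0"
proof -
  define Q where "Q i \<longleftrightarrow> (\<exists>b\<in>zeta P M i. \<forall>n::int. b [^] n = \<one> \<longrightarrow> n = 0)" for i
  have "Q k" using ex_infinite by (simp add: Q_def nil)
  define j where "j = (LEAST i. Q i)"
  have Qj: "Q j" using \<open>Q k\<close> unfolding j_def by (rule LeastI)
  have "j \<noteq> 0"
  proof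
    assume "j = 0"
    with Qj have "\<forall>n::int. \<one> [^] n = \<one> \<longrightarrow> n = 0" by (simp add: Q_def)
    from spec[OF this, of 1] show False by simp
  qed
  then obtain i where i: "j = Suc i" by (cases j) auto
  then have nQ: "\<not> Q i" using not_less_Least[of i Q] by (simp add: j_def)
  obtain b where b: "b \<in> zeta P M (Suc i)" and inf: "\<And>n::int. b [^] n = \<one> \<Longrightarrow> n = 0"
    using Qj by (auto simp: Q_def i simp del: zeta.simps)
  have bP: "b \<in> carrier P" using zeta_carrier[OF b] .
  let ?I = "gen (b \<star> b)"
  have I: "star_ideal ?I" using bP by (simp add: gen_star_ideal)
  note A = ann_star_ideal[OF I]
  have "b \<star> b \<in> zeta P M i" using b bP by simp
  then obtain n :: int where "n \<noteq> 0" "(b \<star> b) [^] n = \<one>" using nQ unfolding Q_def by blast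
  moreover have "\<one> \<in> gen ((b \<star> b) \<star> (b \<star> b))" using bP by (intro star_idealD(2) gen_star_ideal) simp
  ultimately obtain e :: int where e: "e \<noteq> 0" "\<And>x. x \<in> ?I \<Longrightarrow> x [^] e = \<one>"
    using gen_bounded[of "b \<star> b" n] bP by auto
  have b_ann: "b \<in> ann ?I"
  proof (rule ann_gen_infinite[OF bP])
    fix n :: int assume "b [^] n \<in> ?I"
    then have "b [^] (n * e) = \<one>" using e bP by (simp flip: int_pow_pow)
    then show "n = 0" using inf[of "n * e"] e by simp
  qed
  \<comment> \<open>One factor \<open>e\<close> kills all \<open>y \<star> b\<close> by additivity.
    For products with \<open>b\<close> on the left, each further factor \<open>e\<close> descends
    one level.\<close>
  have "\<exists>m::int. m \<noteq> 0 \<and> (\<forall>y\<in>carrier P. y \<star> b [^] m = \<one> \<and> b [^] m \<star> y \<in> zeta P M 0)"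
  proof (rule inc_induct[of 0 k])
    have "y \<star> b [^] e = \<one>" if "y \<in> carrier P" for y
      using b_ann that bP by (auto simp: star_pow ann_def e)
    then show "\<exists>m::int. m \<noteq> 0 \<and> (\<forall>y\<in>carrier P. y \<star> b [^] m = \<one> \<and> b [^] m \<star> y \<in> zeta P M k)"
      using e bP nil by auto
    fix i assume "\<exists>m::int. m \<noteq> 0 \<and> (\<forall>y\<in>carrier P. y \<star> b [^] m = \<one> \<and> b [^] m \<star> y \<in> zeta P M (Suc i))"
    then obtain m :: int where m: "m \<noteq> 0" "\<And>y. y \<in> carrier P \<Longrightarrow> y \<star> b [^] m = \<one>"
      "\<And>y. y \<in> carrier P \<Longrightarrow> b [^] m \<star> y \<in> zeta P M (Suc i)" by blast
    let ?c = "b [^] m"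
    note Z = zeta_star_ideal[of i]
    have c: "?c \<in> carrier P" using bP by simp
    have "y \<star> b [^] (m * e) = \<one> \<and> b [^] (m * e) \<star> y \<in> zeta P M i" if y: "y \<in> carrier P" for y
    proof
      have ce: "b [^] (m * e) = ?c [^] e" using bP by (simp add: int_pow_pow)
      show "y \<star> b [^] (m * e) = \<one>" unfolding ce using y c m by (simp add: star_pow)
      have "?c \<star> (?c \<star> y) \<in> zeta P M i" using m(3)[OF y] c by simp
      moreover have "?c \<star> ?c \<in> ann (zeta P M i)"
        using m(2)[OF c] star_idealD(2)[OF ann_star_ideal(1)[OF Z]] by simp
      ultimately have "bcong (zeta P M i) (?c [^] e \<star> y) ((?c \<star> y) [^] e)"
        using c y by (intro pow_star_bcong Z)
      moreover have "?c \<star> y \<in> ?I" using star_ideal_pow[OF A(1) b_ann] y by (auto simp: ann_def)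
      then have "(?c \<star> y) [^] e = \<one>" by (rule e)
      ultimately show "b [^] (m * e) \<star> y \<in> zeta P M i"
        unfolding ce by (simp add: bcong_one_iff[OF star_idealD(1)[OF Z]])
    qed
    then show "\<exists>m::int. m \<noteq> 0 \<and> (\<forall>y\<in>carrier P. y \<star> b [^] m = \<one> \<and> b [^] m \<star> y \<in> zeta P M i)"
      using m e by (intro exI[of _ "m * e"]) simp
  qed simp
  then obtain m :: int where m: "m \<noteq> 0" "b [^] m \<in> ann {\<one>}" using bP by (auto simp: ann_def)
  have "n = 0" if "(b [^] m) [^] n = \<one>" for n :: int
    using that inf[of "m * n"] m bP by (simp add: int_pow_pow)
  with m(2) show ?thesis by blast
qed

text \<open>If \<open>gen a\<close> has bounded exponent, replace \<open>a\<close> by \<open>a + z\<close> with \<open>z\<close> central of infinite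
order: this changes neither \<open>a \<star> y\<close> nor \<open>y \<star> a\<close>, so both lie in
\<open>gen a \<inter> gen (a + z) = gen (a \<star> a)\<close>.\<close>

lemma ann_gen:
  assumes a: "a \<in> carrier P"
  shows "a \<in> ann (gen (a \<star> a))"
proof (cases "\<exists>n::int. n \<noteq> 0 \<and> a [^] n \<in> gen (a \<star> a)")
  case False
  then show ?thesis using ann_gen_infinite[OF a] by blast
next
  case True
  then obtain e :: int where e: "e \<noteq> 0" "\<And>x. x \<in> gen a \<Longrightarrow> x [^] e = \<one>"
    using gen_bounded[OF a] by blast
  obtain z where z: "z \<in> ann {\<one>}" and z_inf: "\<And>n::int. z [^] n = \<one> \<Longrightarrow> n = 0"
    using ex_central_infinite by blast
  have zP: "z \<in> carrier P" using z by (simp add: ann_def)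
  let ?I = "gen (a \<star> a)" and ?b = "a \<otimes> z"
  have b: "?b \<in> carrier P" using a zP by simp
  have I: "star_ideal ?I" using a by (simp add: gen_star_ideal)
  have G: "star_ideal (gen a)" using a by (simp add: gen_star_ideal)
  note S = star_idealD(1)[OF I] and GS = star_idealD(1)[OF G]
  have "bcong (ann {\<one>}) ?b a"
    using bcong_mult_right[OF star_idealD(1)[OF ann_star_ideal(1)[OF star_ideal_one]] a z] .
  note cong = star_bcong_ann[OF star_ideal_one this, THEN bcong_triv]
  have bb: "?b \<star> ?b = a \<star> a" using cong a b by simp
  \<comment> \<open>Modulo \<open>?I\<close>, \<open>w\<close> is \<open>n\<close> times
    \<open>?b\<close>, so \<open>nz\<close> lies in \<open>gen a\<close>, which \<open>e\<close>
    kills; hence \<open>n = 0\<close>.\<close>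
  have mem: "w \<in> ?I" if w: "w \<in> gen a" "w \<in> gen ?b" for w
  proof -
    obtain n :: int where n: "bcong ?I w (?b [^] n)" using gen_cases[OF b w(2)] bb by auto
    then have "bcong (gen a) w (?b [^] n)" using gen_star_self_subset[OF a] by (auto simp: bcong_def)
    then have "?b [^] n \<in> gen a" using bcong_mem[OF GS bcong_sym[OF GS]] w by blast
    then have "inv (a [^] n) \<otimes> ?b [^] n \<in> gen a"
      using star_idealD(4,5)[OF G] star_ideal_pow[OF G gen_self] by blast
    then have "z [^] n \<in> gen a" using a zP by (simp add: int_pow_distrib cancel)
    then have "z [^] (n * e) = \<one>" using e zP by (simp flip: int_pow_pow)
    then have "n = 0" using z_inf[of "n * e"] e by simp
    then show ?thesis using n by (simp add: bcong_one_iff[OF S])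
  qed
  have "y \<star> a \<in> ?I \<and> a \<star> y \<in> ?I" if y: "y \<in> carrier P" for y
    using star_idealD(6,7)[OF G y gen_self] star_idealD(6,7)[OF gen_star_ideal[OF b] y gen_self]
      cong[OF y] mem by auto
  then show ?thesis using a by (auto simp: ann_def)
qed

end

section \<open>Elements of \<open>p\<close>-power order\<close>

context left_brace
begin

lemma p_component_iff:
  "x \<in> p_component P p K \<longleftrightarrow> x \<in> K \<and> (\<exists>n. x [^] (int p ^ n) = \<one>)"
proof -
  have "x [^] (int p ^ n) = x [^] (p ^ n)" for n
    using int_pow_int[of P x "p ^ n"] by simp
  then show ?thesis by (simp add: p_component_def)
qed

lemma coprime_pow_mem:
  assumes J: "star_ideal J" and c: "c \<in> carrier P" and "c [^] (a::int) \<in> J" "c [^] (b::int) \<in> J" "coprime a b"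
  shows "c \<in> J"
proof -
  obtain u v where "u * a + v * b = 1" using bezout_int[of a b] assms(5) by auto
  then have "c = c [^] (a * u + b * v)" using c by (simp add: mult.commute)
  also have "\<dots> = (c [^] a) [^] u \<otimes> (c [^] b) [^] v" using c by (simp add: int_pow_mult int_pow_pow)
  finally show ?thesis using star_idealD(5)[OF J] star_ideal_pow[OF J] assms by (metis (no_types))
qed

lemma ann_mono: "I \<subseteq> J \<Longrightarrow> ann I \<subseteq> ann J"
  by (auto simp: ann_def)

end

lemma (in dedekind_brace) p_component_star_ideal:
  "star_ideal (p_component P p (carrier P))" (is "star_ideal ?T")
proof (rule dedekind)
  show "subgroup ?T P"
  proof (rule subgroupI)
    show "?T \<subseteq> carrier P" by (auto simp: p_component_iff)
    have "\<one> \<in> ?T" by (simp add: p_component_iff)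
    then show "?T \<noteq> {}" by blast
    fix x assume "x \<in> ?T"
    then obtain n where x: "x \<in> carrier P" "x [^] (int p ^ n) = \<one>" by (auto simp: p_component_iff)
    then show "inv x \<in> ?T" by (auto simp: p_component_iff int_pow_inv)
    fix y assume "y \<in> ?T"
    then obtain m where y: "y \<in> carrier P" "y [^] (int p ^ m) = \<one>" by (auto simp: p_component_iff)
    have "(x \<otimes> y) [^] (int p ^ (n + m)) = (x [^] (int p ^ n)) [^] (int p ^ m) \<otimes> (y [^] (int p ^ m)) [^] (int p ^ n)"
      using x(1) y(1) by (simp add: int_pow_distrib int_pow_pow power_add mult.commute)
    also have "\<dots> = \<one>" using x y by simp
    finally show "x \<otimes> y \<in> ?T" using x y by (auto simp: p_component_iff)
  qed
  show "y \<star> x \<in> ?T" if "y \<in> ?T" "x \<in> ?T" for x y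
    using that by (auto simp: p_component_iff simp flip: star_pow) (metis star_one)
qed

section \<open>Orders and inclusions of the ideals \<open>gen (a \<star> a)\<close>\<close>

context nonperiodic_dedekind_brace
begin

text \<open>Compare \<open>na \<star> a \<equiv> nc\<close> with \<open>na \<star> na \<equiv> n\<^sup>2c\<close>, where \<open>c = a \<star> a\<close>: applying
\<open>ann_gen\<close> to \<open>na\<close> makes \<open>nc\<close> a multiple of \<open>n\<^sup>2c\<close> modulo \<open>gen (c \<star> c)\<close>.\<close>

lemma star_self_pow_mem:
  assumes a: "a \<in> carrier P"
  obtains m :: int where "(a \<star> a) [^] (n - n * n * m) \<in> gen ((a \<star> a) \<star> (a \<star> a))"
proof -
  define c where "c = a \<star> a"
  have c: "c \<in> carrier P" using a by (simp add: c_def)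
  let ?I = "gen (c \<star> c)" and ?b = "a [^] n"
  have I: "star_ideal ?I" using c by (simp add: gen_star_ideal)
  note S = star_idealD(1)[OF I] and A = ann_star_ideal[OF I]
  have c_ann: "c \<in> ann ?I" by (rule ann_gen[OF c])
  define g where "g = ?b \<star> ?b"
  have b: "?b \<in> carrier P" using a by simp
  have g: "g \<in> carrier P" "g = (?b \<star> a) [^] n" using a b by (simp_all add: g_def star_pow)
  have ba: "bcong ?I (?b \<star> a) (c [^] n)"
    using pow_star_bcong[OF I a _ a, of n] c_ann a by (auto simp: c_def ann_def)
  then have gc: "bcong ?I g (c [^] (n * n))"
    using bcong_pow[OF S ba, of n] c by (simp add: g int_pow_pow)
  then have "bcong (ann ?I) g (c [^] (n * n))" using A(2) by (auto simp: bcong_def)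
  then have "g \<in> ann ?I"
    using bcong_mem[OF star_idealD(1)[OF A(1)]] star_ideal_pow[OF A(1) c_ann] by blast
  \<comment> \<open>Lets the relation obtained from \<open>gen_cases\<close> modulo
    \<open>gen (g \<star> g)\<close> be read modulo \<open>?I\<close>.\<close>
  then have gg: "gen (g \<star> g) \<subseteq> ?I" using g(1) by (intro gen_least[OF I]) (auto simp: ann_def)
  have "?b \<star> a \<in> gen g" using ann_gen[OF b] a by (auto simp: ann_def g_def)
  then obtain m :: int where "bcong (gen (g \<star> g)) (?b \<star> a) (g [^] m)" using gen_cases[OF g(1)] by blast
  then have "bcong ?I (?b \<star> a) (g [^] m)" using gg by (auto simp: bcong_def)
  from bcong_trans[OF S bcong_sym[OF S ba] bcong_trans[OF S this bcong_pow[OF S gc]]]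
  have "bcong ?I (c [^] n) (c [^] (n * n * m))" using c by (simp add: int_pow_pow)
  then have "c [^] (n - n * n * m) \<in> ?I" using c by (simp add: bcong_def int_pow_diff)
  then show ?thesis using that by (auto simp: c_def)
qed

text \<open>The case \<open>n = 2\<close> of \<open>star_self_pow_mem\<close>: \<open>2 - 4m\<close>
  is never zero, so \<open>gen_bounded\<close> applies.\<close>

lemma star_self_bounded:
  assumes "a \<in> carrier P"
  shows "\<exists>e::int. e \<noteq> 0 \<and> (\<forall>x\<in>gen (a \<star> a). x [^] e = \<one>)"
proof -
  obtain m :: int where m: "(a \<star> a) [^] (2 - 2 * 2 * m) \<in> gen ((a \<star> a) \<star> (a \<star> a))"
    using star_self_pow_mem[OF assms] .
  have "2 - 2 * 2 * m \<noteq> 0" by presburger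
  then show ?thesis using gen_bounded[OF _ _ m] assms by auto
qed

text \<open>The case \<open>n = p\<close> of \<open>star_self_pow_mem\<close>. The factor
  \<open>1 - pm\<close> is prime to \<open>p\<close>, and \<open>a \<star> a\<close> has
  \<open>p\<close>-power order, so this factor can be cancelled.\<close>

lemma prime_pow_mem:
  assumes p: "prime p" and a: "a \<in> carrier P" "a \<star> a \<in> p_component P p (carrier P)"
  shows "(a \<star> a) [^] (int p) \<in> gen ((a \<star> a) \<star> (a \<star> a))"
proof -
  let ?c = "a \<star> a"
  have I: "star_ideal (gen (?c \<star> ?c))" using a by (simp add: gen_star_ideal)
  obtain m :: int where m: "?c [^] (int p - int p * int p * m) \<in> gen (?c \<star> ?c)"
    using star_self_pow_mem[OF a(1)] .
  obtain N where N: "?c [^] (int p ^ N) = \<one>" using a(2) by (auto simp: p_component_iff)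
  show ?thesis
  proof (rule coprime_pow_mem[OF I])
    show "?c [^] int p \<in> carrier P" using a by simp
    show "(?c [^] int p) [^] (1 - int p * m) \<in> gen (?c \<star> ?c)"
      using m a by (simp add: int_pow_pow algebra_simps)
    have "(?c [^] int p) [^] (int p ^ N) = (?c [^] (int p ^ N)) [^] int p"
      using a by (simp add: int_pow_pow mult.commute)
    then show "(?c [^] int p) [^] (int p ^ N) \<in> gen (?c \<star> ?c)" using N star_idealD(2)[OF I] by simp
    have "coprime (1 - int p * m) (int p)"
    proof (rule coprimeI)
      fix d assume "d dvd 1 - int p * m" "d dvd int p"
      then have "d dvd (1 - int p * m) + int p * m" by (intro dvd_add dvd_mult2)
      then show "is_unit d" by simp
    qed
    then show "coprime (1 - int p * m) (int p ^ N)" by simp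
  qed
qed

text \<open>With \<open>c = x \<star> x\<close>, \<open>prime_pow_mem\<close> shows that
  \<open>gen c\<close> is covered by \<open>p\<close> cosets of \<open>gen (c \<star> c)\<close>;
  and \<open>c \<star> c\<close> lies one level lower.\<close>

lemma card_gen_star_self:
  assumes p: "prime p"
  shows "x \<in> carrier P \<Longrightarrow> x \<star> x \<in> p_component P p (carrier P) \<Longrightarrow> x \<star> x \<in> zeta P M i \<Longrightarrow>
    finite (gen (x \<star> x)) \<and> card (gen (x \<star> x)) \<le> p ^ i"
proof (induction i arbitrary: x)
  case 0
  then have "gen (x \<star> x) \<subseteq> {\<one>}" by (intro gen_least star_ideal_one) simp
  then show ?case using card_mono[of "{\<one>}" "gen (x \<star> x)"] by (auto intro: finite_subset)
next
  case (Suc i)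
  define c where "c = x \<star> x"
  have c: "c \<in> carrier P" "c \<in> p_component P p (carrier P)" "c \<in> zeta P M (Suc i)"
    using Suc.prems by (simp_all add: c_def)
  let ?I = "gen (c \<star> c)"
  have I: "star_ideal ?I" using c by (simp add: gen_star_ideal)
  note S = star_idealD(1)[OF I]
  have fin: "finite ?I" and card: "card ?I \<le> p ^ i"
    using Suc.IH[OF c(1)] c star_idealD(6)[OF p_component_star_ideal c(1,2)] by auto
  have cp: "c [^] int p \<in> ?I" using prime_pow_mem[OF p, of x] Suc.prems by (simp add: c_def)
  have sub: "gen c \<subseteq> (\<Union>j\<in>{..<p}. (\<lambda>i. c [^] j \<otimes> i) ` ?I)"
  proof
    fix y assume "y \<in> gen c"
    then obtain n :: int where n: "bcong ?I y (c [^] n)" using gen_cases[OF c(1)] by blast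
    let ?j = "nat (n mod int p)"
    have p0: "int p > 0" using prime_gt_0_nat[OF p] by simp
    have "c [^] n = c [^] (n mod int p + int p * (n div int p))" by simp
    also have "\<dots> = c [^] (n mod int p) \<otimes> (c [^] int p) [^] (n div int p)"
      using c by (simp only: int_pow_mult int_pow_pow)
    finally have "bcong ?I (c [^] n) (c [^] (n mod int p))"
      using bcong_mult_right[OF S, of "c [^] (n mod int p)"] star_ideal_pow[OF I cp] c by simp
    moreover have "c [^] (n mod int p) = c [^] ?j"
      using int_pow_int[of P c ?j] p0 by simp
    ultimately have "bcong ?I y (c [^] ?j)" using bcong_trans[OF S n] by simp
    then obtain i where "i \<in> ?I" "y = c [^] ?j \<otimes> i" using bcongE[OF S] by blast
    moreover have "?j < p" using p0 by (simp add: nat_less_iff)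
    ultimately show "y \<in> (\<Union>j\<in>{..<p}. (\<lambda>i. c [^] j \<otimes> i) ` ?I)" by blast
  qed
  have "card (\<Union>j\<in>{..<p}. (\<lambda>i. c [^] j \<otimes> i) ` ?I) \<le> (\<Sum>j<p. card ((\<lambda>i. c [^] j \<otimes> i) ` ?I))"
    by (rule card_UN_le) simp
  also have "\<dots> \<le> (\<Sum>j<p. p ^ i)"
    by (intro sum_mono order.trans[OF card_image_le[OF fin] card])
  also have "\<dots> = p ^ Suc i" by simp
  finally have "card (\<Union>j\<in>{..<p}. (\<lambda>i. c [^] j \<otimes> i) ` ?I) \<le> p ^ Suc i" .
  moreover have "finite (\<Union>j\<in>{..<p}. (\<lambda>i. c [^] j \<otimes> i) ` ?I)" using fin by simp
  ultimately show ?case using sub card_mono finite_subset unfolding c_def[symmetric]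
    by (meson order.trans)
qed

text \<open>Repeated star-squaring descends the central series and so ends in \<open>J\<close>; the
  last square outside \<open>J\<close> is taken.\<close>

lemma ex_star_self_minimal:
  assumes J: "star_ideal J"
  shows "x \<in> carrier P \<Longrightarrow> x \<star> x \<in> zeta P M i \<Longrightarrow> x \<star> x \<notin> J \<Longrightarrow>
    \<exists>y\<in>carrier P. y \<star> y \<in> gen (x \<star> x) \<and> y \<star> y \<notin> J \<and> (y \<star> y) \<star> (y \<star> y) \<in> J"
proof (induction i arbitrary: x)
  case 0
  then show ?case using star_idealD(2)[OF J] by auto
next
  case (Suc i)
  let ?c = "x \<star> x"
  show ?case
  proof (cases "?c \<star> ?c \<in> J")
    case True
    then show ?thesis using Suc.prems gen_self by blast
  next
    case False
    have "?c \<star> ?c \<in> zeta P M i" using Suc.prems by simp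
    then show ?thesis
      using Suc.IH[of ?c] False Suc.prems gen_star_self_subset[of ?c] by auto
  qed
qed

text \<open>Otherwise reduce modulo the intersection to \<open>u\<close>, \<open>v\<close> with \<open>c = u \<star> u\<close>, \<open>d = v \<star> v\<close>
independent of order \<open>p\<close> and \<open>u \<star> v = v \<star> u = 0\<close>; then \<open>(u + v) \<star> u = c\<close> would have to be a
multiple of \<open>(u + v) \<star> (u + v) = c + d\<close>.\<close>

lemma gen_star_self_chain:
  assumes p: "prime p" and x: "x \<in> carrier P" "x \<star> x \<in> p_component P p (carrier P)"
    and y: "y \<in> carrier P" "y \<star> y \<in> p_component P p (carrier P)"
  shows "x \<star> x \<in> gen (y \<star> y) \<or> y \<star> y \<in> gen (x \<star> x)"
proof (rule ccontr)
  assume *: "\<not> ?thesis"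
  define J where "J = gen (x \<star> x) \<inter> gen (y \<star> y)"
  have X: "star_ideal (gen (x \<star> x))" and Y: "star_ideal (gen (y \<star> y))"
    using x y by (simp_all add: gen_star_ideal)
  have J: "star_ideal J"
    using X Y subgroups_Inter_pair by (auto simp: star_ideal_def J_def)
  note S = star_idealD(1)[OF J] and A = ann_star_ideal[OF J]
  have "x \<star> x \<notin> J" "y \<star> y \<notin> J" using * by (auto simp: J_def)
  moreover have "x \<star> x \<in> zeta P M k" "y \<star> y \<in> zeta P M k" using x y nil by auto
  ultimately obtain u v where u: "u \<in> carrier P" "u \<star> u \<in> gen (x \<star> x)" "u \<star> u \<notin> J" "(u \<star> u) \<star> (u \<star> u) \<in> J"
    and v: "v \<in> carrier P" "v \<star> v \<in> gen (y \<star> y)" "v \<star> v \<notin> J" "(v \<star> v) \<star> (v \<star> v) \<in> J"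
    using ex_star_self_minimal[OF J x(1)] ex_star_self_minimal[OF J y(1)] by metis
  have ann: "w \<star> w \<in> ann J \<and> (w \<star> w) [^] int p \<in> J"
    if w: "w \<in> carrier P" "(w \<star> w) \<star> (w \<star> w) \<in> J" "w \<star> w \<in> p_component P p (carrier P)" for w
    using ann_gen[of "w \<star> w"] prime_pow_mem[OF p w(1,3)] gen_least[OF J w(2)] ann_mono w by auto
  define c d where "c = u \<star> u" and "d = v \<star> v"
  have [simp]: "u \<in> carrier P" "v \<in> carrier P" "c \<in> carrier P" "d \<in> carrier P"
    using u v by (auto simp: c_def d_def)
  note T = p_component_star_ideal[of p]
  have "c \<in> p_component P p (carrier P)" "d \<in> p_component P p (carrier P)"
    using u v gen_least[OF T] x y unfolding c_def d_def by auto
  then have c: "c \<in> ann J" "c [^] int p \<in> J" and d: "d \<in> ann J" "d [^] int p \<in> J"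
    using ann[of u] ann[of v] u v by (auto simp: c_def d_def)
  \<comment> \<open>The mixed products lie in both ideals by \<open>ann_gen\<close> for
    \<open>u\<close> and for \<open>v\<close>, hence in the intersection \<open>J\<close>.\<close>
  have "u \<star> v \<in> gen c" "v \<star> u \<in> gen c" "u \<star> v \<in> gen d" "v \<star> u \<in> gen d"
    using ann_gen[of u] ann_gen[of v] by (auto simp: ann_def c_def d_def)
  then have uv: "u \<star> v \<in> J" "v \<star> u \<in> J"
    using gen_least[OF X u(2)] gen_least[OF Y v(2)] by (auto simp: J_def c_def d_def)
  define s where "s = u \<otimes> v"
  have s: "s \<in> carrier P" by (simp add: s_def)
  \<comment> \<open>As \<open>u \<star> v\<close> is in \<open>J\<close>, \<open>s\<close> may be
    replaced by the \<open>M\<close>-product of \<open>u\<close> and \<open>v\<close>, to which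
    \<open>M_mult_star\<close> applies.\<close>
  have "bcong J (u \<otimes>\<^bsub>M\<^esub> v) s"
    unfolding s_def M_mult_eq[OF u(1) v(1)] using uv by (intro bcong_mult_right[OF S]) simp
  from star_bcong_left[OF J bcong_sym[OF S this]]
  have sw: "bcong J (s \<star> w) (u \<star> (v \<star> w) \<otimes> u \<star> w \<otimes> v \<star> w)" if "w \<in> carrier P" for w
    using that by (simp add: M_mult_star)
  have drop: "bcong J (a \<otimes> w \<otimes> b) w" if "a \<in> J" "b \<in> J" "w \<in> carrier P" for a b w
  proof -
    have "a \<otimes> w \<otimes> b = w \<otimes> (a \<otimes> b)"
      using that star_idealD(3)[OF J] by (simp add: m_ac)
    then show ?thesis using that bcong_mult_right[OF S] star_idealD(5)[OF J] by simp
  qed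
  have "bcong J (u \<star> (v \<star> u) \<otimes> c \<otimes> v \<star> u) c"
    using uv by (intro drop) (simp_all add: star_idealD[OF J])
  with sw[of u] have su: "bcong J (s \<star> u) c" using bcong_trans[OF S] by (simp add: c_def)
  have "bcong J (u \<star> d \<otimes> d \<otimes> u \<star> v) d"
    using uv d by (intro drop) (auto simp: ann_def)
  moreover have "u \<star> d \<otimes> d \<otimes> u \<star> v = u \<star> (v \<star> v) \<otimes> u \<star> v \<otimes> v \<star> v"
    by (simp add: d_def m_ac)
  ultimately have sv: "bcong J (s \<star> v) d" using bcong_trans[OF S] sw[of v] by simp
  define g where "g = s \<star> s"
  have gP: "g \<in> carrier P" using s by (simp add: g_def)
  have "g = s \<star> u \<otimes> s \<star> v" using s by (simp add: g_def star_mult s_def)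
  with bcong_mult[OF S su sv] have gcd: "bcong J g (c \<otimes> d)" by simp
  then have "bcong (ann J) g (c \<otimes> d)" using A(2) by (auto simp: bcong_def)
  then have "g \<in> ann J"
    using bcong_mem[OF star_idealD(1)[OF A(1)]] star_idealD(5)[OF A(1) c(1) d(1)] by blast
  then have gg: "gen (g \<star> g) \<subseteq> J" using gP by (intro gen_least[OF J]) (auto simp: ann_def)
  have "s \<star> u \<in> gen g" using ann_gen[OF s] by (auto simp: ann_def g_def)
  then obtain n :: int where "bcong (gen (g \<star> g)) (s \<star> u) (g [^] n)" using gen_cases[OF gP] by blast
  then have "bcong J (s \<star> u) (g [^] n)" using gg by (auto simp: bcong_def)
  from bcong_trans[OF S bcong_sym[OF S su] bcong_trans[OF S this bcong_pow[OF S gcd]]]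
  have "bcong J c ((c \<otimes> d) [^] n)" .
  then have "c \<otimes> inv (c [^] n \<otimes> d [^] n) \<in> J" by (simp add: bcong_def int_pow_distrib)
  moreover have "c [^] (1 - n) = c \<otimes> inv (c [^] n)" using int_pow_diff[of c 1 n] by simp
  ultimately have e: "c [^] (1 - n) \<otimes> inv (d [^] n) \<in> J" by (simp add: inv_mult m_ac)
  \<comment> \<open>By \<open>e\<close>, \<open>(1 - n)c\<close> and \<open>nd\<close> agree modulo
    \<open>J\<close>. As they lie in the two ideals meeting in \<open>J\<close>, both are in
    \<open>J\<close>; so \<open>p\<close> divides \<open>1 - n\<close> and \<open>n\<close>.\<close>
  have "c [^] (1 - n) = (c [^] (1 - n) \<otimes> inv (d [^] n)) \<otimes> d [^] n" by (simp add: m_assoc)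
  moreover have "(c [^] (1 - n) \<otimes> inv (d [^] n)) \<otimes> d [^] n \<in> gen (y \<star> y)"
  proof (rule star_idealD(5)[OF Y])
    show "c [^] (1 - n) \<otimes> inv (d [^] n) \<in> gen (y \<star> y)" using e by (simp add: J_def)
    show "d [^] n \<in> gen (y \<star> y)" using v star_ideal_pow[OF Y] by (simp add: d_def)
  qed
  moreover have "c [^] (1 - n) \<in> gen (x \<star> x)" using u star_ideal_pow[OF X] by (auto simp: c_def)
  ultimately have cn: "c [^] (1 - n) \<in> J" by (simp add: J_def)
  have "d [^] n = inv (c [^] (1 - n) \<otimes> inv (d [^] n)) \<otimes> c [^] (1 - n)"
    by (simp add: inv_mult m_ac cancel)
  then have dn: "d [^] n \<in> J" using star_idealD(4,5)[OF J] e cn by metis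
  have dvd: "int p dvd m" if "w \<in> carrier P" "w \<notin> J" "w [^] int p \<in> J" "w [^] m \<in> J" for w m
    using coprime_pow_mem[OF J that(1,3,4)] that(2) p prime_imp_coprime[of "int p" m] by auto
  have "int p dvd n" using dvd[OF _ _ d(2) dn] v by (simp add: d_def)
  moreover have "int p dvd 1 - n" using dvd[OF _ _ c(2) cn] u by (simp add: c_def)
  ultimately have "int p dvd 1" by (metis diff_add_cancel dvd_add)
  then show False using p by simp
qed

text \<open>The orders are bounded by \<open>card_gen_star_self\<close>, so a largest ideal
  \<open>?G\<close> exists, and by the chain property it contains the others. Up to factors prime to
  \<open>p\<close>, every star product lies in \<open>?G\<close>.\<close>

lemma p_component_bound:
  assumes p: "prime p" and k: "k > 0"
  defines "K \<equiv> p_component P p (bstar_set P M (carrier P) (carrier P))"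
  shows "finite K \<and> card K \<le> p ^ (k - 1)"
proof -
  let ?T = "p_component P p (carrier P)"
  define X where "X = {x \<in> carrier P. x \<star> x \<in> ?T}"
  have card: "finite (gen (x \<star> x)) \<and> card (gen (x \<star> x)) \<le> p ^ (k - 1)" if x: "x \<in> X" for x
  proof (rule card_gen_star_self[OF p])
    \<comment> \<open>The exponent is \<open>k - 1\<close> because star squares lie one level below
      the top.\<close>
    have "x \<in> zeta P M (Suc (k - 1))" using x k nil by (simp add: X_def del: zeta.simps)
    then show "x \<star> x \<in> zeta P M (k - 1)" using x by (simp add: X_def)
  qed (use x in \<open>simp_all add: X_def\<close>)
  have "\<one> \<in> X" using star_idealD(2)[OF p_component_star_ideal] by (simp add: X_def)
  then obtain g where g: "g \<in> X" and max: "\<And>x. x \<in> X \<Longrightarrow> card (gen (x \<star> x)) \<le> card (gen (g \<star> g))"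
    using ex_has_greatest_nat[of "\<lambda>x. x \<in> X" \<one> "\<lambda>x. card (gen (x \<star> x))" "Suc (p ^ (k - 1))"] card
    by (auto simp: less_Suc_eq_le)
  let ?G = "gen (g \<star> g)"
  have gP: "g \<in> carrier P" using g by (simp add: X_def)
  have G: "star_ideal ?G" using gP by (simp add: gen_star_ideal)
  have sub: "gen (x \<star> x) \<subseteq> ?G" if x: "x \<in> X" for x
  proof -
    have "x \<star> x \<in> ?G \<or> g \<star> g \<in> gen (x \<star> x)"
      using gen_star_self_chain[OF p] x g by (auto simp: X_def)
    then have "gen (x \<star> x) \<subseteq> ?G \<or> ?G \<subseteq> gen (x \<star> x)"
      using gen_subset[of "x \<star> x" "g \<star> g"] gen_subset[of "g \<star> g" "x \<star> x"] x gP by (auto simp: X_def)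
    then show ?thesis using card_seteq[of "gen (x \<star> x)" ?G] card[OF x] max[OF x] by auto
  qed
  define L where "L = {w \<in> carrier P. \<exists>s::int. coprime s (int p) \<and> w [^] s \<in> ?G}"
  have "subgroup L P"
  proof (rule subgroupI)
    show "L \<subseteq> carrier P" by (auto simp: L_def)
    have "\<one> \<in> L" using star_idealD(2)[OF G] by (auto simp: L_def intro: exI[of _ 1])
    then show "L \<noteq> {}" by blast
    fix a assume "a \<in> L"
    then obtain s :: int where s: "a \<in> carrier P" "coprime s (int p)" "a [^] s \<in> ?G" by (auto simp: L_def)
    then show "inv a \<in> L" using star_idealD(4)[OF G] by (auto simp: L_def int_pow_inv)
    fix b assume "b \<in> L"
    then obtain t :: int where t: "b \<in> carrier P" "coprime t (int p)" "b [^] t \<in> ?G" by (auto simp: L_def)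
    have "(a \<otimes> b) [^] (s * t) = (a [^] s) [^] t \<otimes> (b [^] t) [^] s"
      using s t by (simp add: int_pow_distrib int_pow_pow mult.commute)
    also have "\<dots> \<in> ?G" using s t star_ideal_pow[OF G] star_idealD(5)[OF G] by blast
    finally show "a \<otimes> b \<in> L" using s t by (auto simp: L_def intro!: exI[of _ "s * t"])
  qed
  moreover have "y \<star> x \<in> L" if y: "y \<in> carrier P" and x: "x \<in> carrier P" for x y
  proof -
    obtain e :: int where e: "e \<noteq> 0" "\<And>w. w \<in> gen (x \<star> x) \<Longrightarrow> w [^] e = \<one>"
      using star_self_bounded[OF x] by blast
    have pp: "prime (int p)" using p by simp
    \<comment> \<open>Multiplying \<open>x\<close> by the part \<open>s\<close> of \<open>e\<close>
      prime to \<open>p\<close> turns its star square into a \<open>p\<close>-element.\<close>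
    obtain s where s: "e = int p ^ multiplicity (int p) e * s" "\<not> int p dvd s"
      using multiplicity_decompose'[OF e(1) prime_elem_not_unit[OF prime_imp_prime_elem[OF pp]]] by blast
    have "x [^] s \<star> x \<in> gen (x \<star> x)" using ann_gen[OF x] x by (simp add: ann_def)
    then have "(x [^] s \<star> x) [^] e = \<one>" by (rule e)
    then have "(x [^] s \<star> x [^] s) [^] (int p ^ multiplicity (int p) e) = \<one>"
      using x s(1) by (simp add: star_pow int_pow_pow mult.commute)
    then have "x [^] s \<in> X" using x by (auto simp: X_def p_component_iff)
    moreover have "y \<star> x [^] s \<in> gen (x [^] s \<star> x [^] s)"
      using ann_gen[of "x [^] s"] x y by (simp add: ann_def)
    ultimately have "y \<star> x [^] s \<in> ?G" using sub by blast
    moreover have "coprime s (int p)"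
      using prime_imp_coprime[OF pp s(2)] by (simp add: coprime_commute)
    ultimately show ?thesis using x y by (auto simp: L_def star_pow)
  qed
  ultimately have "bstar_set P M (carrier P) (carrier P) \<subseteq> L"
    unfolding bstar_set_def by (intro generate_subgroup_incl) auto
  have "K \<subseteq> ?G"
  proof
    fix w assume w: "w \<in> K"
    then have "w \<in> L" using \<open>bstar_set P M (carrier P) (carrier P) \<subseteq> L\<close> by (auto simp: K_def p_component_def)
    then obtain s :: int where s: "w \<in> carrier P" "coprime s (int p)" "w [^] s \<in> ?G" by (auto simp: L_def)
    obtain n where "w [^] (int p ^ n) = \<one>" using w by (auto simp: K_def p_component_iff)
    then have "w [^] (int p ^ n) \<in> ?G" using star_idealD(2)[OF G] by simp
    then show "w \<in> ?G" using coprime_pow_mem[OF G s(1,3)] s(2) by simp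
  qed
  then show ?thesis using card[OF g] card_mono[of ?G K] finite_subset[of K ?G] by auto
qed

end

theorem theoremB:
  fixes P M :: "'a monoid" and k :: nat
  assumes "T_brace P M"
    and "smok_nilpotent P M"
    and "k > 0"
    and "zeta P M k = carrier P"
    and "zeta P M (k - 1) \<noteq> carrier P"
    and "\<not> periodic_group P"
  shows "\<forall>p::nat. prime p \<longrightarrow>
           finite (p_component P p (bstar_set P M (carrier P) (carrier P))) \<and>
           card (p_component P p (bstar_set P M (carrier P) (carrier P))) \<le> p ^ (k - 1)"
proof -
  have "brace P M" using assms(1) by (simp add: T_brace_def)
  then interpret left_brace P M
    by (intro left_brace.intro left_brace_axioms.intro) (simp_all add: brace_def)
  interpret nonperiodic_dedekind_brace P M k
    by unfold_locales (use assms T_brace_star_closed[OF assms(1,4)] in auto)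
  show ?thesis using p_component_bound assms(3) by blast
qed

end
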